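(* For $\alpha=(\alpha_1,\dots,\alpha_g)\in\mathbb{R}^g$, set $\sigma^2(\alpha):=\alpha^{\dagger}\mathbf{\Sigma}\alpha$. Then \[ \sigma^2(\alpha)=2\sum_i\alpha_i^2\pi_E(e_i)-2\Big\langle(I-P)^{-1}\Big(\sum_i\alpha_if_i\Big),\sum_j\alpha_jf_j\Big\rangle_\pi . \] In particular, \[ 2\sum_i\alpha_i^2\pi_E(e_i)-\frac{2\|\sum_i\alpha_if_i\|_\pi^2}{\delta}\ \le\ \sigma^2(\alpha)\ \le\ 2\sum_i\alpha_i^2\pi_E(e_i)-\frac{2\|\sum_i\alpha_if_i\|_\pi^2}{1-\gamma_{\min}}. \]
   Context: Setting: - $G$ is a finite connected simple graph. - $(X_t)$ is a Markov chain on $V(G)$ with transition matrix $P$, where $P(x,y)=0$ unless $x=y$ or $\{x,y\}$ is an edge. - The chain is irreducible, aperiodic, lazy ($P(x,x)\ge1/2$, so all eigenvalues of $P$ are nonnegative), and reversible with respect to its stationary distribution $\pi$. Edge-walk: - The edge-walk is $Y_t=(X_t,X_{t+1})$ on $\mathcal{E}(G)=\{(x,y):P(x,y)\ne0\}$. - Its stationary distribution is $\pi_E$. Accumulated homology and $\mathbf{\Sigma}$: - Fix a spanning tree of $G$ with complementary edges $e_1,\dots,e_g$, oriented as $e_i=(x_i,y_i)$; write $\pi_E(e_i)=\pi_E(x_i,y_i)$. - $H_1(\rho_X(t))\in\mathbb{Z}^g$ has $i$-th coordinate equal to the number of steps of $X_0,\dots,X_t$ from $x_i$ to $y_i$ minus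 the number of steps from $y_i$ to $x_i$. - $\mathbf{\Sigma}$ is the $g\times g$ matrix such that $H_1(\rho_X(t))/\sqrt t$ converges in distribution to $\mathcal{N}(0,\mathbf{\Sigma})$. Functions, norms and inverse: - $f_i:V(G)\to\mathbb{R}$ takes value $P(x_i,y_i)$ at $x_i$, $-P(y_i,x_i)$ at $y_i$, and $0$ elsewhere. - $\langle u,v\rangle_\pi=\sum_x\pi(x)u(x)v(x)$ and $\|u\|_\pi^2=\langle u,u\rangle_\pi$. - For $h$ with $\sum_x\pi(x)h(x)=0$, $(I-P)^{-1}h$ denotes a function $u$ with $(I-P)u=h$ and $\sum_x\pi(x)u(x)=0$. The pairing above does not depend on the additive constant. Spectral quantities: $\delta$ is the spectral gap of $P$ (one minus the largest eigenvalue different from the simple eigenvalue $1$), and $\gamma_{\min}$ is the smallest eigenvalue of $P$. *)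

theory Defs
  imports "HOL-Probability.Probability"
begin

section \<open>Finite simple graphs on the vertex set \<open>UNIV :: 'v set\<close>\<close>

definition simple_graph :: "'v::finite set set \<Rightarrow> bool" where
  "simple_graph E \<longleftrightarrow> (\<forall>e\<in>E. card e = 2)"

definition graph_connected :: "'v::finite set set \<Rightarrow> bool" where
  "graph_connected E \<longleftrightarrow> (\<forall>u v. (u, v) \<in> {(a, b). {a, b} \<in> E}\<^sup>*)"

definition graph_cycle :: "'v::finite set set \<Rightarrow> 'v list \<Rightarrow> bool" where
  "graph_cycle E c \<longleftrightarrow> 3 \<le> length c \<and> distinct c \<and>
     (\<forall>k<length c. {c ! k, c ! (Suc k mod length c)} \<in> E)"

definition spanning_tree :: "'v::finite set set \<Rightarrow> 'v set set \<Rightarrow> bool" where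
  "spanning_tree E T \<longleftrightarrow> T \<subseteq> E \<and> graph_connected T \<and> (\<nexists>c. graph_cycle T c)"

text \<open>
  The complementary edges of the tree \<open>T\<close>, enumerated without repetition as
  \<open>{x 1, y 1}, \<dots>, {x g, y g}\<close> and oriented as \<open>(x i, y i)\<close>. The case \<open>g = 0\<close> is allowed.
\<close>
definition oriented_complement ::
    "'v::finite set set \<Rightarrow> 'v set set \<Rightarrow> nat \<Rightarrow> (nat \<Rightarrow> 'v) \<Rightarrow> (nat \<Rightarrow> 'v) \<Rightarrow> bool" where
  "oriented_complement E T g x y \<longleftrightarrow> bij_betw (\<lambda>i. {x i, y i}) {1..g} (E - T)"


section \<open>Finite Markov chains\<close>

definition stochastic :: "real^'s^'s::finite \<Rightarrow> bool" where
  "stochastic P \<longleftrightarrow> (\<forall>a b. 0 \<le> P $ a $ b) \<and> (\<forall>a. (\<Sum>b\<in>UNIV. P $ a $ b) = 1)"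

definition supported_on_graph :: "'v::finite set set \<Rightarrow> real^'v^'v \<Rightarrow> bool" where
  "supported_on_graph E P \<longleftrightarrow> (\<forall>a b. a \<noteq> b \<longrightarrow> {a, b} \<notin> E \<longrightarrow> P $ a $ b = 0)"

text \<open>Matrix power; the overloaded \<open>^\<close> would be the componentwise power here.\<close>
primrec mpow :: "real^'s^'s::finite \<Rightarrow> nat \<Rightarrow> real^'s^'s" where
  "mpow P 0 = mat 1"
| "mpow P (Suc n) = P ** mpow P n"

definition irreducible_chain :: "real^'s^'s::finite \<Rightarrow> bool" where
  "irreducible_chain P \<longleftrightarrow> (\<forall>a b. \<exists>n. 0 < mpow P n $ a $ b)"

definition aperiodic_chain :: "real^'s^'s::finite \<Rightarrow> bool" where
  "aperiodic_chain P \<longleftrightarrow> (\<forall>a. Gcd {n. 0 < n \<and> 0 < mpow P n $ a $ a} = 1)"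

definition lazy_chain :: "real^'s^'s::finite \<Rightarrow> bool" where
  "lazy_chain P \<longleftrightarrow> (\<forall>a. 1 / 2 \<le> P $ a $ a)"

definition stationary_distribution :: "real^'s^'s::finite \<Rightarrow> real^'s \<Rightarrow> bool" where
  "stationary_distribution P \<pi> \<longleftrightarrow>
     (\<forall>a. 0 \<le> \<pi> $ a) \<and> (\<Sum>a\<in>UNIV. \<pi> $ a) = 1 \<and> \<pi> v* P = \<pi>"

definition reversible_chain :: "real^'s^'s::finite \<Rightarrow> real^'s \<Rightarrow> bool" where
  "reversible_chain P \<pi> \<longleftrightarrow> (\<forall>a b. \<pi> $ a * P $ a $ b = \<pi> $ b * P $ b $ a)"

text \<open>The initial distribution of the chain is arbitrary.\<close>
definition markov_chain :: "'a measure \<Rightarrow> (nat \<Rightarrow> 'a \<Rightarrow> 's::finite) \<Rightarrow> real^'s^'s \<Rightarrow> bool" where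
  "markov_chain M X P \<longleftrightarrow> prob_space M \<and>
     (\<forall>t. X t \<in> measurable M (count_space UNIV)) \<and>
     (\<forall>t z. measure M {\<omega> \<in> space M. \<forall>s\<le>Suc t. X s \<omega> = z s} =
            measure M {\<omega> \<in> space M. \<forall>s\<le>t. X s \<omega> = z s} * P $ z t $ z (Suc t))"

definition edge_states :: "real^'v^'v::finite \<Rightarrow> ('v \<times> 'v) set" where
  "edge_states P = {(a, b). P $ a $ b \<noteq> 0}"

definition edge_walk :: "real^'v^'v::finite \<Rightarrow> real^('v \<times> 'v)^('v \<times> 'v)" where
  "edge_walk P = (\<chi> p q. if fst q = snd p then P $ fst q $ snd q else 0)"

text \<open>
  The stationary distribution of the edge-walk \<open>Y t = (X t, X (t + 1))\<close>.
  A distribution on \<open>edge_states P\<close> is a vector indexed by all pairs that vanishes off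
  \<open>edge_states P\<close>. Rows of \<open>edge_walk P\<close> outside that set are then irrelevant.
\<close>
definition edge_stationary :: "real^'v^'v::finite \<Rightarrow> real^('v \<times> 'v) \<Rightarrow> bool" where
  "edge_stationary P \<pi>E \<longleftrightarrow>
     (\<forall>p. p \<notin> edge_states P \<longrightarrow> \<pi>E $ p = 0) \<and> stationary_distribution (edge_walk P) \<pi>E"


section \<open>Accumulated homology and its limiting covariance matrix\<close>

definition homology ::
    "(nat \<Rightarrow> 'v) \<Rightarrow> (nat \<Rightarrow> 'v) \<Rightarrow> (nat \<Rightarrow> 'a \<Rightarrow> 'v) \<Rightarrow> nat \<Rightarrow> 'a \<Rightarrow> nat \<Rightarrow> int" where
  "homology x y X t \<omega> i =
     int (card {s. s < t \<and> X s \<omega> = x i \<and> X (Suc s) \<omega> = y i})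
   - int (card {s. s < t \<and> X s \<omega> = y i \<and> X (Suc s) \<omega> = x i})"

text \<open>
  The dimension \<open>g\<close> depends on the graph and may be \<open>0\<close>, so the space of real \<open>g\<close>-vectors is
  rendered by the functions in \<open>PiE {1..g} (\<lambda>_. UNIV)\<close>, with the product topology and the
  product Borel sigma-algebra; \<open>g \<times> g\<close> matrices are functions of two indices in \<open>{1..g}\<close>.
\<close>

abbreviation borel_vec :: "nat \<Rightarrow> (nat \<Rightarrow> real) measure" where
  "borel_vec g \<equiv> Pi\<^sub>M {1..g} (\<lambda>_. borel)"

definition scaled_homology ::
    "nat \<Rightarrow> (nat \<Rightarrow> 'v) \<Rightarrow> (nat \<Rightarrow> 'v) \<Rightarrow> (nat \<Rightarrow> 'a \<Rightarrow> 'v) \<Rightarrow> nat \<Rightarrow> 'a \<Rightarrow> nat \<Rightarrow> real" where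
  "scaled_homology g x y X t \<omega> = (\<lambda>i\<in>{1..g}. of_int (homology x y X t \<omega> i) / sqrt (real t))"

definition quad_form :: "nat \<Rightarrow> (nat \<Rightarrow> nat \<Rightarrow> real) \<Rightarrow> (nat \<Rightarrow> real) \<Rightarrow> real" where
  "quad_form g S \<alpha> = (\<Sum>i=1..g. \<Sum>j=1..g. \<alpha> i * S i j * \<alpha> j)"

text \<open>
  The centred normal law with (possibly singular) covariance matrix \<open>S\<close>, given by its
  characteristic function. A singular \<open>S\<close> has no density. Positive semidefiniteness of \<open>S\<close>
  follows, as a characteristic function is bounded by \<open>1\<close>.
\<close>
definition centred_normal ::
    "nat \<Rightarrow> (nat \<Rightarrow> nat \<Rightarrow> real) \<Rightarrow> (nat \<Rightarrow> real) measure \<Rightarrow> bool" where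
  "centred_normal g S N \<longleftrightarrow>
     prob_space N \<and> sets N = sets (borel_vec g) \<and>
     (\<forall>i\<in>{1..g}. \<forall>j\<in>{1..g}. S i j = S j i) \<and>
     (\<forall>\<beta>. (CLINT v|N. iexp (\<Sum>i=1..g. \<beta> i * v i)) = complex_of_real (exp (- quad_form g S \<beta> / 2)))"

text \<open>
  Convergence in distribution; the library's \<open>weak_conv_m\<close> covers only laws on the real line.
\<close>
definition weak_conv_vec ::
    "nat \<Rightarrow> (nat \<Rightarrow> (nat \<Rightarrow> real) measure) \<Rightarrow> (nat \<Rightarrow> real) measure \<Rightarrow> bool" where
  "weak_conv_vec g L N \<longleftrightarrow>
     (\<forall>h :: (nat \<Rightarrow> real) \<Rightarrow> real.
        continuous_on (PiE {1..g} (\<lambda>_. UNIV)) h \<longrightarrow> bounded (h ` PiE {1..g} (\<lambda>_. UNIV)) \<longrightarrow>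
        (\<lambda>t. \<integral>v. h v \<partial>L t) \<longlonglongrightarrow> (\<integral>v. h v \<partial>N))"

definition homology_covariance ::
    "'a measure \<Rightarrow> (nat \<Rightarrow> 'a \<Rightarrow> 'v) \<Rightarrow> nat \<Rightarrow> (nat \<Rightarrow> 'v) \<Rightarrow> (nat \<Rightarrow> 'v) \<Rightarrow>
      (nat \<Rightarrow> nat \<Rightarrow> real) \<Rightarrow> bool" where
  "homology_covariance M X g x y S \<longleftrightarrow>
     (\<exists>N. centred_normal g S N \<and>
          weak_conv_vec g (\<lambda>t. distr M (borel_vec g) (scaled_homology g x y X t)) N)"


section \<open>Functions on the vertices and spectral quantities\<close>

definition edge_fun :: "real^'v^'v::finite \<Rightarrow> (nat \<Rightarrow> 'v) \<Rightarrow> (nat \<Rightarrow> 'v) \<Rightarrow> nat \<Rightarrow> real^'v" where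
  "edge_fun P x y i =
     (\<chi> a. if a = x i then P $ x i $ y i else if a = y i then - P $ y i $ x i else 0)"

definition inner_pi :: "real^'s::finite \<Rightarrow> real^'s \<Rightarrow> real^'s \<Rightarrow> real" where
  "inner_pi \<pi> u v = (\<Sum>a\<in>UNIV. \<pi> $ a * u $ a * v $ a)"

definition norm_pi :: "real^'s::finite \<Rightarrow> real^'s \<Rightarrow> real" where
  "norm_pi \<pi> u = sqrt (inner_pi \<pi> u u)"

definition inv_I_minus :: "real^'s^'s::finite \<Rightarrow> real^'s \<Rightarrow> real^'s \<Rightarrow> real^'s" where
  "inv_I_minus P \<pi> h = (THE u. (mat 1 - P) *v u = h \<and> (\<Sum>a\<in>UNIV. \<pi> $ a * u $ a) = 0)"

text \<open>
  Real eigenvalues, acting on functions \<open>u\<close>. For a reversible chain all eigenvalues are real.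
\<close>
definition eigenvalues :: "real^'s^'s::finite \<Rightarrow> real set" where
  "eigenvalues P = {l. \<exists>u. u \<noteq> 0 \<and> P *v u = l *\<^sub>R u}"

text \<open>
  For a one-vertex graph there is no eigenvalue other than \<open>1\<close> and \<open>spectral_gap\<close> is
  an unspecified number.
\<close>
definition spectral_gap :: "real^'s^'s::finite \<Rightarrow> real" where
  "spectral_gap P = 1 - Max (eigenvalues P - {1})"

definition min_eigenvalue :: "real^'s^'s::finite \<Rightarrow> real" where
  "min_eigenvalue P = Min (eigenvalues P)"

end

theory Submission
  imports Defs
begin

text \<open>
  The limit law is given only through its characteristic function, so its variance is recovered
  without a central limit theorem. Let \<open>\<phi>\<close> be the antisymmetric edge function with
  \<open>\<Sum>i. \<alpha> i * H i = \<Sum>s<t. \<phi> (X s) (X (s + 1))\<close>, let \<open>h = \<Sum>i. \<alpha> i f i\<close> be its drift and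
  \<open>(I - P) u = h\<close>. Up to the bounded term \<open>u (X 0) - u (X t)\<close> the sum is a martingale with
  bounded increments \<open>d a b = \<phi> a b + u b - u a\<close>. Its second moment divided by \<open>t\<close> tends to the
  stationary mean of \<open>d\<^sup>2\<close> and its fourth moment is \<open>O(t\<^sup>2)\<close>. Expanding the cosine to fourth order
  bounds \<open>exp (- \<theta>\<^sup>2 q / 2) - 1 + \<theta>\<^sup>2 s / 2\<close> by \<open>C \<theta>\<^sup>4\<close>, where \<open>q\<close> is the variance of the limit and \<open>s\<close>
  that stationary mean; hence \<open>q = s\<close>. Reversibility and antisymmetry evaluate \<open>s\<close>.

  For the bounds, the Rayleigh quotient controls the Dirichlet form \<open>\<langle>u, (I - P) u\<rangle>\<close> by the spectral
  gap and by the least eigenvalue. Two Cauchy-Schwarz inequalities, one for \<open>\<langle>\<cdot>, \<cdot>\<rangle>\<close> and one for the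
  Dirichlet form, transfer these bounds to \<open>\<langle>(I - P)\<inverse> h, h\<rangle>\<close>.
\<close>

section \<open>Reversible chains and the Poisson equation\<close>

locale reversible_irreducible_chain =
  fixes P :: "real^'v^'v::finite" and \<pi> :: "real^'v"
  assumes stochastic: "stochastic P"
    and irreducible: "irreducible_chain P"
    and stationary: "stationary_distribution P \<pi>"
    and reversible: "reversible_chain P \<pi>"
begin

lemma nonneg: "0 \<le> P $ a $ b"
  and row_sum: "(\<Sum>b\<in>UNIV. P $ a $ b) = 1"
  using stochastic by (auto simp: stochastic_def)

lemma detailed_balance: "\<pi> $ a * P $ a $ b = \<pi> $ b * P $ b $ a"
  using reversible by (auto simp: reversible_chain_def)

lemma \<pi>_nonneg: "0 \<le> \<pi> $ a" and \<pi>_sum: "(\<Sum>a\<in>UNIV. \<pi> $ a) = 1"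
  and \<pi>_invariant: "\<pi> v* P = \<pi>"
  using stationary by (auto simp: stationary_distribution_def)

lemma mpow_nonneg: "0 \<le> mpow P n $ a $ b"
  by (induction n arbitrary: a b)
    (auto simp: mat_def matrix_matrix_mult_def nonneg intro!: sum_nonneg mult_nonneg_nonneg)

lemma mpow_row_sum: "(\<Sum>b\<in>UNIV. mpow P n $ a $ b) = 1"
proof (induction n arbitrary: a)
  case 0
  show ?case by (simp add: mat_def)
next
  case (Suc n)
  have "(\<Sum>b\<in>UNIV. mpow P (Suc n) $ a $ b) = (\<Sum>c\<in>UNIV. \<Sum>b\<in>UNIV. P $ a $ c * mpow P n $ c $ b)"
    by (subst sum.swap) (simp add: matrix_matrix_mult_def)
  also have "\<dots> = 1"
    by (simp add: sum_distrib_left[symmetric] Suc row_sum)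
  finally show ?case .
qed

text \<open>Some state \<open>a\<close> has positive mass. \<pi> is invariant under every power of
  \<open>P\<close>, and irreducibility supplies a power that carries part of this mass to
  \<open>b\<close>.\<close>

lemma \<pi>_pos: "0 < \<pi> $ b"
proof -
  have inv: "\<pi> v* mpow P n = \<pi>" for n
    by (induction n) (simp_all add: vector_matrix_mul_assoc[symmetric] \<pi>_invariant)
  obtain a where a: "0 < \<pi> $ a"
    using \<pi>_sum \<pi>_nonneg by (metis less_eq_real_def sum.neutral zero_neq_one)
  obtain n where n: "0 < mpow P n $ a $ b"
    using irreducible by (auto simp: irreducible_chain_def)
  have "0 < \<pi> $ a * mpow P n $ a $ b" using a n by simp
  also have "\<dots> \<le> (\<Sum>c\<in>UNIV. \<pi> $ c * mpow P n $ c $ b)"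
    by (rule member_le_sum) (auto simp: \<pi>_nonneg mpow_nonneg)
  also have "\<dots> = (\<pi> v* mpow P n) $ b"
    by (simp add: vector_matrix_mult_def mult.commute)
  finally show ?thesis by (simp add: inv)
qed

text \<open>Maximum principle: harmonicity passes to all powers of \<open>P\<close>, so at a
  maximiser \<open>m\<close> a weighted sum of the nonnegative numbers \<open>u $ m - u $ d\<close>
  vanishes. Irreducibility gives any chosen state positive weight in one of these sums.\<close>

lemma harmonic_imp_constant:
  assumes "P *v u = u"
  shows "u $ a = u $ b"
proof -
  have inv: "mpow P n *v u = u" for n
    by (induction n) (simp_all add: matrix_vector_mul_assoc[symmetric] assms)
  obtain m where m: "\<And>c. u $ c \<le> u $ m"
  proof -
    obtain m where "u $ m = Max (range (($) u))"
      using Max_in[of "range (($) u)"] by (metis UNIV_not_empty empty_is_image finite finite_imageI imageE)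
    then have "u $ c \<le> u $ m" for c by simp
    then show thesis by (rule that)
  qed
  have "u $ c = u $ m" for c
  proof -
    obtain n where n: "0 < mpow P n $ m $ c"
      using irreducible by (auto simp: irreducible_chain_def)
    have "(\<Sum>d\<in>UNIV. mpow P n $ m $ d * (u $ m - u $ d)) = u $ m - (mpow P n *v u) $ m"
      by (simp add: right_diff_distrib sum_subtractf sum_distrib_right[symmetric] mpow_row_sum
          matrix_vector_mult_def)
    then have "(\<Sum>d\<in>UNIV. mpow P n $ m $ d * (u $ m - u $ d)) = 0" by (simp add: inv)
    then have "mpow P n $ m $ c * (u $ m - u $ c) = 0"
      by (subst (asm) sum_nonneg_eq_0_iff) (auto simp: mpow_nonneg m)
    then show ?thesis using n by simp
  qed
  then show ?thesis by metis
qed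

lemma mean_apply: "(\<Sum>a\<in>UNIV. \<pi> $ a * (P *v u) $ a) = (\<Sum>a\<in>UNIV. \<pi> $ a * u $ a)"
proof -
  have "(\<Sum>a\<in>UNIV. \<pi> $ a * (P *v u) $ a) = \<pi> \<bullet> (P *v u)"
    by (simp add: inner_vec_def)
  also have "\<dots> = (\<pi> v* P) \<bullet> u" by (simp add: dot_lmul_matrix)
  finally show ?thesis by (simp add: \<pi>_invariant inner_vec_def)
qed

lemma harmonic_mean_zero:
  assumes "P *v u = u" "(\<Sum>a\<in>UNIV. \<pi> $ a * u $ a) = 0"
  shows "u = 0"
proof -
  obtain c where c: "\<And>a. u $ a = c" using harmonic_imp_constant[OF assms(1)] by metis
  then have "c = 0" using assms(2) by (simp add: sum_distrib_right[symmetric] \<pi>_sum)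
  then show ?thesis by (simp add: vec_eq_iff c)
qed

lemma poisson_exists:
  assumes "(\<Sum>a\<in>UNIV. \<pi> $ a * h $ a) = 0"
  obtains u where "u - P *v u = h" "(\<Sum>a\<in>UNIV. \<pi> $ a * u $ a) = 0"
proof -
  \<comment> \<open>Adding the mean makes \<open>I - P\<close> injective, hence onto.\<close>
  define A where "A u = u - P *v u + (\<chi> b. \<Sum>a\<in>UNIV. \<pi> $ a * u $ a)" for u
  \<comment> \<open>Since \<open>u - P *v u\<close> has mean zero, the mean of \<open>A u\<close>
    comes from the added constant alone. Both a kernel vector of \<open>A\<close> and a preimage of
    the centred \<open>h\<close> are therefore centred, and on centred functions \<open>A\<close> is
    \<open>I - P\<close>.\<close>
  have mean: "(\<Sum>a\<in>UNIV. \<pi> $ a * A u $ a) = (\<Sum>a\<in>UNIV. \<pi> $ a * u $ a)" for u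
    by (simp add: A_def distrib_left right_diff_distrib sum.distrib sum_subtractf mean_apply
        sum_distrib_right[symmetric] \<pi>_sum)
  have lin: "linear A"
    by (rule linearI) (simp_all add: A_def vec_eq_iff matrix_vector_right_distrib
        matrix_vector_mult_scaleR sum.distrib sum_distrib_left algebra_simps)
  have A0: "A u = u - P *v u" if "(\<Sum>a\<in>UNIV. \<pi> $ a * u $ a) = 0" for u
    using that by (simp add: A_def vec_eq_iff)
  have "u = 0" if "A u = 0" for u
  proof -
    have "(\<Sum>a\<in>UNIV. \<pi> $ a * u $ a) = 0" using mean[of u] that by simp
    with A0[OF this] that show "u = 0" by (intro harmonic_mean_zero) auto
  qed
  then have "inj A" using lin by (simp add: linear_injective_0)
  then have "surj A" using lin by (simp add: linear_injective_imp_surjective)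
  then obtain u where u: "A u = h" by (metis surjD)
  then have "(\<Sum>a\<in>UNIV. \<pi> $ a * u $ a) = 0" using mean[of u] assms by simp
  with A0 u that show thesis by metis
qed

lemma poisson_unique:
  assumes "u - P *v u = h" "(\<Sum>a\<in>UNIV. \<pi> $ a * u $ a) = 0"
    and "v - P *v v = h" "(\<Sum>a\<in>UNIV. \<pi> $ a * v $ a) = 0"
  shows "u = v"
proof -
  have "u - v - P *v (u - v) = (u - P *v u) - (v - P *v v)"
    by (simp add: matrix_vector_mult_diff_distrib)
  then have "P *v (u - v) = u - v"
    using assms(1,3) by simp
  then have "u - v = 0"
    by (rule harmonic_mean_zero) (simp add: right_diff_distrib sum_subtractf assms(2,4))
  then show ?thesis by simp
qed

text \<open>Resolves the definite description: it denotes the centred Poisson solution because that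
  solution is unique.\<close>

lemma inv_I_minus_eq:
  assumes "u - P *v u = h" "(\<Sum>a\<in>UNIV. \<pi> $ a * u $ a) = 0"
  shows "inv_I_minus P \<pi> h = u"
  unfolding inv_I_minus_def
  unfolding matrix_vector_mult_diff_rdistrib matrix_vector_mul_lid
  using assms by (blast intro: the_equality poisson_unique)

text \<open>By detailed balance the density of \<mu> with respect to \<pi> is harmonic, hence
  constant, and normalisation makes the constant 1.\<close>

lemma stationary_unique:
  assumes "stationary_distribution P \<mu>"
  shows "\<mu> = \<pi>"
proof -
  define u where "u = (\<chi> a. \<mu> $ a / \<pi> $ a)"
  have ne: "\<pi> $ a \<noteq> 0" for a using \<pi>_pos[of a] by simp
  have "(P *v u) $ a = u $ a" for a
  proof -
    have "P $ a $ b * (\<mu> $ b / \<pi> $ b) = \<mu> $ b * P $ b $ a / \<pi> $ a" for b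
      using detailed_balance[of a b] ne by (simp add: field_simps)
    then have "(P *v u) $ a = (\<mu> v* P) $ a / \<pi> $ a"
      by (simp add: matrix_vector_mult_def vector_matrix_mult_def u_def sum_divide_distrib)
    then show ?thesis using assms by (simp add: stationary_distribution_def u_def)
  qed
  then have "u $ a = u $ b" for a b by (intro harmonic_imp_constant) (simp add: vec_eq_iff)
  then obtain c where c: "\<And>a. u $ a = c" by metis
  have \<mu>: "\<mu> $ a = c * \<pi> $ a" for a using c[of a] ne by (simp add: u_def field_simps)
  have "(\<Sum>a\<in>UNIV. \<mu> $ a) = 1" using assms by (simp add: stationary_distribution_def)
  then have "c = 1" by (simp add: \<mu> sum_distrib_left[symmetric] \<pi>_sum)
  then show ?thesis by (simp add: \<mu> vec_eq_iff)
qed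

text \<open>One step of invariance forces \<open>\<pi>E $ (a, b)\<close> to be the second marginal
  of \<open>\<pi>E\<close> at \<open>a\<close> times \<open>P $ a $ b\<close>. Summing over
  \<open>a\<close> shows that this marginal is stationary for \<open>P\<close>, so it is
  \<pi>.\<close>

lemma edge_stationary_eq:
  assumes "edge_stationary P \<pi>E"
  shows "\<pi>E $ (a, b) = \<pi> $ a * P $ a $ b"
proof -
  define \<mu> where "\<mu> = (\<chi> b. \<Sum>a\<in>UNIV. \<pi>E $ (a, b))"
  have st: "stationary_distribution (edge_walk P) \<pi>E"
    using assms by (simp add: edge_stationary_def)
  have E: "\<pi>E $ (a, b) = \<mu> $ a * P $ a $ b" for a b
  proof -
    have "\<pi>E $ (a, b) = (\<pi>E v* edge_walk P) $ (a, b)"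
      using st by (simp add: stationary_distribution_def)
    also have "\<dots> = (\<Sum>p\<in>UNIV \<times> UNIV. \<pi>E $ p * (if a = snd p then P $ a $ b else 0))"
      by (simp add: vector_matrix_mult_def edge_walk_def cong: if_cong)
    also have "\<dots> = (\<Sum>c\<in>UNIV. \<Sum>d\<in>UNIV. if a = d then \<pi>E $ (c, d) * P $ a $ b else 0)"
      by (subst sum.cartesian_product) (auto intro!: sum.cong)
    also have "\<dots> = \<mu> $ a * P $ a $ b"
      by (simp add: \<mu>_def sum_distrib_right)
    finally show ?thesis .
  qed
  have "stationary_distribution P \<mu>"
    unfolding stationary_distribution_def
  proof (intro conjI allI)
    show "0 \<le> \<mu> $ a" for a
      using st by (auto simp: stationary_distribution_def \<mu>_def intro!: sum_nonneg)
    have "(\<Sum>a\<in>UNIV. \<mu> $ a) = (\<Sum>p\<in>UNIV \<times> UNIV. \<pi>E $ p)"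
      unfolding \<mu>_def vec_lambda_beta by (subst sum.swap) (simp add: sum.cartesian_product)
    then show "(\<Sum>a\<in>UNIV. \<mu> $ a) = 1"
      using st by (simp add: stationary_distribution_def)
    have "(\<mu> v* P) $ b = \<mu> $ b" for b
      by (simp add: vector_matrix_mult_def mult.commute flip: E) (simp add: \<mu>_def)
    then show "\<mu> v* P = \<mu>" by (simp add: vec_eq_iff)
  qed
  then have "\<mu> = \<pi>" by (rule stationary_unique)
  then show ?thesis by (simp add: E)
qed

end

section \<open>Spectral bounds for the Dirichlet form\<close>

text \<open>The usual discriminant argument for a semidefinite form; \<open>b v v = 0\<close> must
  be allowed, because it is applied to forms that degenerate.\<close>

lemma psd_cauchy_schwarz:
  fixes b :: "'a::real_vector \<Rightarrow> 'a \<Rightarrow> real"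
  assumes "bilinear b" and sym: "b u v = b v u"
    and psd: "\<And>t. 0 \<le> b (u + t *\<^sub>R v) (u + t *\<^sub>R v)" and "0 \<le> b v v"
  shows "(b u v)\<^sup>2 \<le> b u u * b v v"
proof -
  have q: "0 \<le> b u u + 2 * t * b u v + t\<^sup>2 * b v v" for t
    using psd[of t] sym assms(1)
    by (simp add: bilinear_ladd bilinear_radd bilinear_lmul bilinear_rmul power2_eq_square algebra_simps)
  show ?thesis
  proof (cases "b v v = 0")
    case True
    have "b u v = 0"
    proof (rule ccontr)
      assume "b u v \<noteq> 0"
      \<comment> \<open>With the quadratic term gone, this \<open>t\<close> gives the affine
        function the value -1.\<close>
      then show False using q[of "- (b u u + 1) / (2 * b u v)"] True by (simp add: field_simps)
    qed
    then show ?thesis using True by simp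
  next
    case False
    \<comment> \<open>The minimiser of the quadratic.\<close>
    then show ?thesis using q[of "- b u v / b v v"] \<open>0 \<le> b v v\<close>
      by (simp add: field_simps power2_eq_square)
  qed
qed

text \<open>The Rayleigh quotient attains its maximum on the compact Euclidean unit sphere of
  \<open>V\<close>. As it is invariant under scaling, the maximum \<open>l\<close> bounds it on all
  nonzero vectors of \<open>V\<close>, and the maximiser is an eigenvector.\<close>

lemma rayleigh_maximum:
  fixes b :: "'a::euclidean_space \<Rightarrow> 'a \<Rightarrow> real"
  assumes b: "bilinear b" and sym: "\<And>u v. b u v = b v u" and pos: "\<And>u. u \<noteq> 0 \<Longrightarrow> 0 < b u u"
    and f: "linear f" and self_adjoint: "\<And>u v. b (f u) v = b u (f v)"
    and V: "subspace V" and inv: "\<And>u. u \<in> V \<Longrightarrow> f u \<in> V" and ne: "w \<in> V" "w \<noteq> 0"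
  obtains l v where "v \<in> V" "v \<noteq> 0" "f v = l *\<^sub>R v" "\<And>u. u \<in> V \<Longrightarrow> b (f u) u \<le> l * b u u"
proof -
  let ?K = "sphere 0 1 \<inter> V"
  define q where "q u = b (f u) u / b u u" for u
  have "(1 / norm w) *\<^sub>R w \<in> ?K" using ne V by (simp add: subspace_scale)
  then have "?K \<noteq> {}" by blast
  moreover have "compact ?K" using V by (intro compact_Int_closed closed_subspace) auto
  moreover have "continuous_on ?K q" unfolding q_def
  proof (intro continuous_intros ballI)
    show "continuous_on ?K (\<lambda>u. b (f u) u)"
      by (rule bilinear_continuous_on_compose[OF _ _ b])
        (use f in \<open>auto intro: linear_continuous_on linear_linear continuous_on_id simp: linear_conv_bounded_linear\<close>)
    show "continuous_on ?K (\<lambda>u. b u u)"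
      by (rule bilinear_continuous_on_compose[OF _ _ b]) (auto intro: continuous_on_id)
    show "b u u \<noteq> 0" if "u \<in> ?K" for u using pos[of u] that by force
  qed
  ultimately obtain v where v: "v \<in> ?K" and max: "\<And>u. u \<in> ?K \<Longrightarrow> q u \<le> q v"
    using continuous_attains_sup by metis
  define l where "l = q v"
  have v0: "v \<noteq> 0" "v \<in> V" using v by auto
  have le: "b (f u) u \<le> l * b u u" if "u \<in> V" for u
  proof (cases "u = 0")
    case True
    then show ?thesis using b by (simp add: bilinear_rzero)
  next
    case False
    have "q ((1 / norm u) *\<^sub>R u) \<le> l"
      unfolding l_def by (rule max) (use that False V in \<open>simp add: subspace_scale\<close>)
    then show ?thesis using False pos[of u] b f unfolding q_def
      by (simp add: linear_scale bilinear_lmul bilinear_rmul field_simps)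
  qed
  \<comment> \<open>The form \<open>c\<close> is semidefinite on \<open>V\<close> and vanishes at
    the maximiser \<open>v\<close>, so Cauchy-Schwarz gives \<open>c v w = 0\<close>. For
    \<open>w = l *\<^sub>R v - f v\<close> this number is \<open>b w w\<close>, which yields the
    eigenvector equation without differentiation.\<close>
  define c where "c u w = l * b u w - b (f u) w" for u w
  have c: "bilinear c"
    using b f unfolding bilinear_def c_def
    by (auto intro!: linearI simp: linear_add linear_scale bilinear_ladd bilinear_radd bilinear_lmul bilinear_rmul
        algebra_simps b)
  define w where "w = l *\<^sub>R v - f v"
  have w: "w \<in> V" unfolding w_def using v0 V inv by (simp add: subspace_diff subspace_scale)
  have "c v v = 0" using pos[OF v0(1)] by (simp add: c_def l_def q_def)
  moreover have "(c v w)\<^sup>2 \<le> c v v * c w w"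
  proof (rule psd_cauchy_schwarz[OF c])
    show "c v w = c w v" unfolding c_def by (metis sym self_adjoint)
    show "0 \<le> c (v + t *\<^sub>R w) (v + t *\<^sub>R w)" for t
      using le[of "v + t *\<^sub>R w"] v0 w V by (simp add: c_def subspace_add subspace_scale)
    show "0 \<le> c w w" using le[OF w] by (simp add: c_def)
  qed
  ultimately have "c v w = 0" by simp
  moreover have "c v w = b w w"
    using b by (simp add: c_def w_def bilinear_lsub bilinear_lmul)
  ultimately have "w = 0" using pos[of w] by force
  then have "f v = l *\<^sub>R v" by (simp add: w_def)
  with v0 le that show thesis by blast
qed

section \<open>Self-adjointness, Poincare inequality and Dirichlet bounds for a reversible
  chain\<close>

context reversible_irreducible_chain
begin

lemma bilinear_inner_pi: "bilinear (inner_pi \<pi>)"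
  unfolding bilinear_def inner_pi_def
  by (auto intro!: linearI simp: sum.distrib sum_distrib_left algebra_simps)

lemma inner_pi_commute: "inner_pi \<pi> u v = inner_pi \<pi> v u"
  by (simp add: inner_pi_def mult_ac)

lemma inner_pi_pos: "u \<noteq> 0 \<Longrightarrow> 0 < inner_pi \<pi> u u"
proof -
  assume "u \<noteq> 0"
  then obtain a where "u $ a \<noteq> 0" by (auto simp: vec_eq_iff)
  then show ?thesis unfolding inner_pi_def
    by (intro sum_pos2[where i = a]) (auto simp: mult.assoc \<pi>_pos \<pi>_nonneg zero_less_mult_iff)
qed

lemma inner_pi_self_adjoint: "inner_pi \<pi> (P *v u) v = inner_pi \<pi> u (P *v v)"
proof -
  have "inner_pi \<pi> (P *v u) v = (\<Sum>a\<in>UNIV. \<Sum>b\<in>UNIV. \<pi> $ a * P $ a $ b * u $ b * v $ a)"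
    by (simp add: inner_pi_def matrix_vector_mult_def sum_distrib_left sum_distrib_right mult_ac)
  also have "\<dots> = (\<Sum>b\<in>UNIV. \<Sum>a\<in>UNIV. \<pi> $ b * P $ b $ a * u $ b * v $ a)"
    by (subst sum.swap) (simp add: detailed_balance[of _ "_ :: 'v"])
  also have "\<dots> = inner_pi \<pi> u (P *v v)"
    by (simp add: inner_pi_def matrix_vector_mult_def sum_distrib_left mult_ac)
  finally show ?thesis .
qed

text \<open>The weights \<open>\<pi> $ a * P $ a $ b\<close> have both marginals equal to \<pi>;
  bound the product \<open>u $ a * u $ b\<close> by half the sum of the squares.\<close>

lemma inner_pi_apply_le: "inner_pi \<pi> (P *v u) u \<le> inner_pi \<pi> u u"
proof -
  have s: "(\<Sum>a\<in>UNIV. \<Sum>b\<in>UNIV. \<pi> $ a * P $ a $ b * (u $ a)\<^sup>2) = inner_pi \<pi> u u"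
    by (simp add: inner_pi_def sum_distrib_right[symmetric] sum_distrib_left[symmetric] row_sum
        power2_eq_square mult_ac)
  have t: "(\<Sum>a\<in>UNIV. \<Sum>b\<in>UNIV. \<pi> $ a * P $ a $ b * (u $ b)\<^sup>2) = inner_pi \<pi> u u"
    by (subst s[symmetric], subst sum.swap) (simp add: detailed_balance)
  have "inner_pi \<pi> (P *v u) u = (\<Sum>a\<in>UNIV. \<Sum>b\<in>UNIV. \<pi> $ a * P $ a $ b * (u $ a * u $ b))"
    by (simp add: inner_pi_def matrix_vector_mult_def sum_distrib_left sum_distrib_right mult_ac)
  also have "\<dots> \<le> (\<Sum>a\<in>UNIV. \<Sum>b\<in>UNIV. \<pi> $ a * P $ a $ b * ((u $ a)\<^sup>2 / 2 + (u $ b)\<^sup>2 / 2))"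
  proof (intro sum_mono mult_left_mono)
    show "u $ a * u $ b \<le> (u $ a)\<^sup>2 / 2 + (u $ b)\<^sup>2 / 2" for a b
      using sum_squares_bound[of "u $ a" "u $ b"] by simp
  qed (simp add: \<pi>_nonneg nonneg)
  also have "\<dots> = inner_pi \<pi> u u"
    using s t by (simp add: distrib_left sum.distrib sum_divide_distrib[symmetric])
  finally show ?thesis .
qed

text \<open>Makes the \<open>Max\<close> and \<open>Min\<close> in the spectral quantities
  meaningful. Scaling by \<open>sqrt (\<pi> $ a)\<close> turns \<pi>-orthogonality of eigenvectors
  for distinct eigenvalues into Euclidean orthogonality, hence linear independence.\<close>

lemma finite_eigenvalues: "finite (eigenvalues P)"
proof -
  define e where "e l = (SOME u. u \<noteq> 0 \<and> P *v u = l *\<^sub>R u)" for l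
  have e: "e l \<noteq> 0 \<and> P *v e l = l *\<^sub>R e l" if "l \<in> eigenvalues P" for l
    using that unfolding e_def eigenvalues_def mem_Collect_eq by (rule someI_ex)
  define w where "w l = (\<chi> a. sqrt (\<pi> $ a) * e l $ a)" for l
  have w_inner: "w l \<bullet> w m = inner_pi \<pi> (e l) (e m)" for l m
    using \<pi>_nonneg by (auto simp: w_def inner_vec_def inner_pi_def intro!: sum.cong)
  have orth: "w l \<bullet> w m = 0" if "l \<in> eigenvalues P" "m \<in> eigenvalues P" "l \<noteq> m" for l m
  proof -
    have "l * inner_pi \<pi> (e l) (e m) = m * inner_pi \<pi> (e l) (e m)"
      using inner_pi_self_adjoint[of "e l" "e m"] e[OF that(1)] e[OF that(2)]
      by (simp add: bilinear_lmul[OF bilinear_inner_pi] bilinear_rmul[OF bilinear_inner_pi])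
    then show ?thesis using that by (simp add: w_inner)
  qed
  have pos: "0 < w l \<bullet> w l" if "l \<in> eigenvalues P" for l
    using e[OF that] by (simp add: w_inner inner_pi_pos)
  have "pairwise orthogonal (w ` eigenvalues P)"
    by (auto simp: pairwise_def orthogonal_def intro: orth)
  moreover have "0 \<notin> w ` eigenvalues P" using pos by force
  ultimately have "finite (w ` eigenvalues P)"
    by (intro independent_imp_finite pairwise_orthogonal_independent)
  moreover have "inj_on w (eigenvalues P)"
    using orth pos by (intro inj_onI) (metis less_irrefl)
  ultimately show ?thesis by (rule finite_imageD)
qed

lemma eigenvalue_le_1:
  assumes "l \<in> eigenvalues P"
  shows "l \<le> 1"
proof -
  obtain e where e: "e \<noteq> 0" "P *v e = l *\<^sub>R e" using assms by (auto simp: eigenvalues_def)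
  then have "l * inner_pi \<pi> e e \<le> 1 * inner_pi \<pi> e e"
    using inner_pi_apply_le[of e] by (simp add: bilinear_lmul[OF bilinear_inner_pi])
  then show ?thesis using inner_pi_pos[OF e(1)] by simp
qed

text \<open>Maximise the Rayleigh quotient on the centred functions. The maximum is an eigenvalue
  with a centred eigenvector, so it differs from 1 and is at most the second eigenvalue. The nonzero
  \<open>u\<close> guarantees that an eigenvalue other than 1 exists.\<close>

lemma poincare_inequality:
  assumes "(\<Sum>a\<in>UNIV. \<pi> $ a * u $ a) = 0" "u \<noteq> 0"
  shows "0 < spectral_gap P" "spectral_gap P * inner_pi \<pi> u u \<le> inner_pi \<pi> u (u - P *v u)"
proof -
  let ?V = "{u. (\<Sum>a\<in>UNIV. \<pi> $ a * u $ a) = 0}"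
  obtain l v where v: "v \<in> ?V" "v \<noteq> 0" "P *v v = l *\<^sub>R v"
    and le: "\<And>u. u \<in> ?V \<Longrightarrow> inner_pi \<pi> (P *v u) u \<le> l * inner_pi \<pi> u u"
  proof (rule rayleigh_maximum[OF bilinear_inner_pi inner_pi_commute inner_pi_pos _ inner_pi_self_adjoint,
        where V = ?V and w = u])
    show "subspace ?V"
      by (auto simp: subspace_def algebra_simps sum.distrib sum_distrib_left[symmetric])
  qed (use assms mean_apply in auto)
  have "l \<noteq> 1" using harmonic_mean_zero[of v] v by auto
  then have l: "l \<in> eigenvalues P - {1}" using v by (auto simp: eigenvalues_def)
  then have "l \<le> Max (eigenvalues P - {1})" by (simp add: finite_eigenvalues)
  then have *: "spectral_gap P \<le> 1 - l" by (simp add: spectral_gap_def)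
  have "Max (eigenvalues P - {1}) \<in> eigenvalues P - {1}"
    using l by (intro Max_in) (auto simp: finite_eigenvalues)
  then show "0 < spectral_gap P" using eigenvalue_le_1 by (force simp: spectral_gap_def)
  have "spectral_gap P * inner_pi \<pi> u u \<le> (1 - l) * inner_pi \<pi> u u"
    using * inner_pi_pos[OF assms(2)] by (intro mult_right_mono) auto
  also have "\<dots> \<le> inner_pi \<pi> u (u - P *v u)"
    using le[of u] assms inner_pi_self_adjoint[of u u]
    by (simp add: bilinear_rsub[OF bilinear_inner_pi] algebra_simps)
  finally show "spectral_gap P * inner_pi \<pi> u u \<le> inner_pi \<pi> u (u - P *v u)" .
qed

text \<open>Apply the Rayleigh maximum to \<open>-P\<close> on the whole space: the maximal quotient
  is minus an eigenvalue of \<open>P\<close>.\<close>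

lemma min_eigenvalue_bound:
  "inner_pi \<pi> u (u - P *v u) \<le> (1 - min_eigenvalue P) * inner_pi \<pi> u u"
proof (cases "u = 0")
  case True
  then show ?thesis by (simp add: inner_pi_def)
next
  case False
  obtain l v where v: "v \<noteq> 0" "- (P *v v) = l *\<^sub>R v"
    and le: "\<And>u. inner_pi \<pi> (- (P *v u)) u \<le> l * inner_pi \<pi> u u"
  proof (rule rayleigh_maximum[OF bilinear_inner_pi inner_pi_commute inner_pi_pos,
        where V = UNIV and w = u and f = "\<lambda>u. - (P *v u)"])
    show "linear (\<lambda>u. - (P *v u))" by (rule linear_compose_neg) simp
    show "inner_pi \<pi> (- (P *v u)) v = inner_pi \<pi> u (- (P *v v))" for u v
      using inner_pi_self_adjoint
      by (simp add: bilinear_lneg[OF bilinear_inner_pi] bilinear_rneg[OF bilinear_inner_pi])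
  qed (use False in auto)
  have "P *v v = (- l) *\<^sub>R v" using v(2) by (metis minus_equation_iff scaleR_minus_left)
  then have "- l \<in> eigenvalues P" using v unfolding eigenvalues_def by blast
  then have "min_eigenvalue P \<le> - l" by (simp add: min_eigenvalue_def finite_eigenvalues)
  then have "(1 + l) * inner_pi \<pi> u u \<le> (1 - min_eigenvalue P) * inner_pi \<pi> u u"
    using inner_pi_pos[OF False] by (intro mult_right_mono) auto
  moreover have "inner_pi \<pi> u (u - P *v u) \<le> (1 + l) * inner_pi \<pi> u u"
    using le[of u] inner_pi_self_adjoint[of u u]
    by (simp add: bilinear_rsub[OF bilinear_inner_pi] bilinear_lneg[OF bilinear_inner_pi] algebra_simps)
  ultimately show ?thesis by simp
qed

lemma bilinear_dirichlet: "bilinear (\<lambda>u v. inner_pi \<pi> u (v - P *v v))"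
  using bilinear_inner_pi unfolding bilinear_def
  by (auto intro!: linearI simp: bilinear_ladd[OF bilinear_inner_pi] bilinear_lmul[OF bilinear_inner_pi]
      bilinear_radd[OF bilinear_inner_pi] bilinear_rmul[OF bilinear_inner_pi]
      bilinear_rsub[OF bilinear_inner_pi] matrix_vector_right_distrib matrix_vector_mult_scaleR
      algebra_simps)

lemma dirichlet_cauchy_schwarz:
  "(inner_pi \<pi> u (v - P *v v))\<^sup>2 \<le> inner_pi \<pi> u (u - P *v u) * inner_pi \<pi> v (v - P *v v)"
proof (rule psd_cauchy_schwarz[OF bilinear_dirichlet])
  show "inner_pi \<pi> u (v - P *v v) = inner_pi \<pi> v (u - P *v u)"
    using inner_pi_self_adjoint[of u v] inner_pi_commute
    by (metis bilinear_rsub[OF bilinear_inner_pi])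
  have *: "0 \<le> inner_pi \<pi> u (u - P *v u)" for u
    using inner_pi_apply_le[of u] inner_pi_self_adjoint[of u u]
    by (simp add: bilinear_rsub[OF bilinear_inner_pi])
  show "0 \<le> inner_pi \<pi> v (v - P *v v)"
    and "0 \<le> inner_pi \<pi> (u + t *\<^sub>R v) ((u + t *\<^sub>R v) - P *v (u + t *\<^sub>R v))" for t
    by (rule *)+
qed

text \<open>Cauchy-Schwarz bounds the square of \<langle>u, h\<rangle> by \<langle>u, u\<rangle>
  \<langle>h, h\<rangle>, and the Poincare inequality bounds \<langle>u, u\<rangle> by \<langle>u,
  h\<rangle> over the gap; a positive factor \<langle>u, h\<rangle> cancels.\<close>

lemma dirichlet_upper:
  assumes "u - P *v u = h" "(\<Sum>a\<in>UNIV. \<pi> $ a * u $ a) = 0"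
  shows "inner_pi \<pi> u h \<le> inner_pi \<pi> h h / spectral_gap P"
proof (cases "u = 0")
  \<comment> \<open>Here \<open>h = 0\<close>, so both sides vanish whatever
    \<open>spectral_gap P\<close> is. This covers the one-vertex graph.\<close>
  case True
  then show ?thesis using assms(1) by (simp add: inner_pi_def)
next
  case False
  note gap = poincare_inequality[OF assms(2) False, unfolded assms(1)]
  have pos: "0 < inner_pi \<pi> u u" using False by (rule inner_pi_pos)
  have ip: "0 < inner_pi \<pi> u h" using gap pos by (smt (verit) mult_pos_pos)
  have "0 \<le> inner_pi \<pi> v v" for v
    using inner_pi_pos[of v] by (cases "v = 0") (auto simp: inner_pi_def)
  then have "(inner_pi \<pi> u h)\<^sup>2 \<le> inner_pi \<pi> u u * inner_pi \<pi> h h"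
    by (intro psd_cauchy_schwarz[OF bilinear_inner_pi inner_pi_commute])
  then have "spectral_gap P * (inner_pi \<pi> u h)\<^sup>2 \<le> spectral_gap P * (inner_pi \<pi> u u * inner_pi \<pi> h h)"
    using gap by (intro mult_left_mono) auto
  also have "\<dots> \<le> inner_pi \<pi> u h * inner_pi \<pi> h h"
    unfolding mult.assoc[symmetric] using gap \<open>\<And>v. 0 \<le> inner_pi \<pi> v v\<close> by (intro mult_right_mono)
  finally have "spectral_gap P * inner_pi \<pi> u h \<le> inner_pi \<pi> h h"
    using ip by (simp add: power2_eq_square)
  then show ?thesis using gap by (simp add: field_simps)
qed

text \<open>Cauchy-Schwarz for the Dirichlet form, applied to \<open>h\<close> and \<open>u\<close>,
  bounds the square of \<langle>h, h\<rangle> by \<langle>h, (I - P) h\<rangle> \<langle>u,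
  h\<rangle>; the least eigenvalue controls the first factor.\<close>

lemma dirichlet_lower:
  assumes "u - P *v u = h"
  shows "inner_pi \<pi> h h / (1 - min_eigenvalue P) \<le> inner_pi \<pi> u h"
proof (cases "h = 0")
  case True
  then show ?thesis by (simp add: inner_pi_def)
next
  case False
  let ?n = "inner_pi \<pi> h h" and ?c = "1 - min_eigenvalue P"
  have n: "0 < ?n" using False by (rule inner_pi_pos)
  have nn: "0 \<le> inner_pi \<pi> u h"
    using inner_pi_apply_le[of u] inner_pi_self_adjoint[of u u]
    by (simp add: bilinear_rsub[OF bilinear_inner_pi] flip: assms)
  have "(inner_pi \<pi> h h)\<^sup>2 \<le> inner_pi \<pi> h (h - P *v h) * inner_pi \<pi> u h"
    using dirichlet_cauchy_schwarz[of h u] by (simp add: assms)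
  also have "\<dots> \<le> ?c * ?n * inner_pi \<pi> u h"
    using min_eigenvalue_bound nn by (intro mult_right_mono)
  finally have *: "?n \<le> ?c * inner_pi \<pi> u h" using n by (simp add: power2_eq_square)
  \<comment> \<open>The inequality just proved forces the denominator to be positive, which
    justifies the division.\<close>
  then have "0 < ?c" using n nn by (smt (verit) mult_nonpos_nonneg)
  then show ?thesis using * by (simp add: field_simps)
qed

end

section \<open>Expectations along the path\<close>

text \<open>Adaptedness to the natural filtration at time \<open>t\<close>, phrased
  pathwise.\<close>

definition determined_by :: "(nat \<Rightarrow> 'a \<Rightarrow> 's) \<Rightarrow> nat \<Rightarrow> ('a \<Rightarrow> 'b) \<Rightarrow> bool" where
  "determined_by X t f \<longleftrightarrow> (\<forall>\<omega> \<omega>'. (\<forall>s\<le>t. X s \<omega> = X s \<omega>') \<longrightarrow> f \<omega> = f \<omega>')"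

definition cylinder :: "'a measure \<Rightarrow> (nat \<Rightarrow> 'a \<Rightarrow> 's) \<Rightarrow> nat \<Rightarrow> (nat \<Rightarrow> 's) \<Rightarrow> 'a set" where
  "cylinder M X t z = {\<omega> \<in> space M. \<forall>s\<le>t. X s \<omega> = z s}"

locale finite_markov_chain =
  fixes M :: "'a measure" and X :: "nat \<Rightarrow> 'a \<Rightarrow> 's::finite" and P :: "real^'s^'s"
  assumes markov: "markov_chain M X P"
begin

sublocale prob_space M
  using markov by (simp add: markov_chain_def)

lemma X_measurable [measurable]: "X t \<in> measurable M (count_space UNIV)"
  using markov by (simp add: markov_chain_def)

lemma cylinder_sets [measurable]: "cylinder M X t z \<in> sets M"
  unfolding cylinder_def by measurable

lemma integrable_cylinder: "integrable M (\<lambda>\<omega>. indicator (cylinder M X t z) \<omega> :: real)"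
  by (rule integrable_real_indicator) (auto simp: less_top[symmetric])

lemma cylinder_Suc:
  "measure M (cylinder M X (Suc t) z) = measure M (cylinder M X t z) * P $ z t $ z (Suc t)"
  using markov by (simp add: markov_chain_def cylinder_def)

text \<open>Only finitely many initial paths exist, so \<open>f\<close> is a finite combination of
  cylinder indicators. The coefficients precede the quantifier over \<open>H\<close>, so that
  \<open>H\<close> may later depend on the sample point.\<close>

lemma determined_by_cylinders:
  fixes f :: "'a \<Rightarrow> real"
  assumes "determined_by X t f"
  shows "\<exists>c. \<forall>H. \<forall>\<omega>\<in>space M. f \<omega> * H (X t \<omega>) =
      (\<Sum>z\<in>PiE {..t} (\<lambda>_. UNIV). c z * H (z t) * indicator (cylinder M X t z) \<omega>)"
proof -
  \<comment> \<open>For a path \<open>z\<close> that no sample point realises, the value is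
    arbitrary, but the cylinder is empty.\<close>
  define c where "c z = f (SOME \<omega>. \<forall>s\<le>t. X s \<omega> = z s)" for z
  have c: "f \<omega> = c (\<lambda>s\<in>{..t}. X s \<omega>)" for \<omega>
  proof -
    have "\<forall>s\<le>t. X s (SOME \<omega>'. \<forall>s\<le>t. X s \<omega>' = (\<lambda>s\<in>{..t}. X s \<omega>) s) = (\<lambda>s\<in>{..t}. X s \<omega>) s"
      by (rule someI_ex[of "\<lambda>\<omega>'. \<forall>s\<le>t. X s \<omega>' = (\<lambda>s\<in>{..t}. X s \<omega>) s"]) auto
    then show ?thesis using assms unfolding c_def determined_by_def by (simp add: restrict_def)
  qed
  have ind: "indicator (cylinder M X t z) \<omega> = (if z = (\<lambda>s\<in>{..t}. X s \<omega>) then 1 else 0 :: real)"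
    if "\<omega> \<in> space M" "z \<in> PiE {..t} (\<lambda>_. UNIV)" for \<omega> z
    using that by (auto simp: cylinder_def indicator_def fun_eq_iff PiE_def extensional_def)
  have "f \<omega> * H (X t \<omega>) =
      (\<Sum>z\<in>PiE {..t} (\<lambda>_. UNIV). c z * H (z t) * indicator (cylinder M X t z) \<omega>)"
    if "\<omega> \<in> space M" for H \<omega>
  proof -
    have "(\<Sum>z\<in>PiE {..t} (\<lambda>_. UNIV). c z * H (z t) * indicator (cylinder M X t z) \<omega>) =
        (\<Sum>z\<in>PiE {..t} (\<lambda>_. UNIV). if z = (\<lambda>s\<in>{..t}. X s \<omega>) then c z * H (z t) else 0)"
      by (intro sum.cong) (auto simp: ind[OF that])
    also have "\<dots> = c (\<lambda>s\<in>{..t}. X s \<omega>) * H (X t \<omega>)"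
      by (subst sum.delta) (auto simp: finite_PiE)
    finally show ?thesis by (simp add: c)
  qed
  then show ?thesis by blast
qed

lemma determined_by_integrable:
  fixes f :: "'a \<Rightarrow> real"
  assumes "determined_by X t f"
  shows "integrable M f"
proof -
  obtain c where f: "\<forall>H. \<forall>\<omega>\<in>space M. f \<omega> * H (X t \<omega>) =
      (\<Sum>z\<in>PiE {..t} (\<lambda>_. UNIV). c z * H (z t) * indicator (cylinder M X t z) \<omega>)"
    using determined_by_cylinders[OF assms] by blast
  from f[rule_format, of _ "\<lambda>_. 1"]
  have "integrable M f \<longleftrightarrow> integrable M (\<lambda>\<omega>. \<Sum>z\<in>PiE {..t} (\<lambda>_. UNIV). c z * indicator (cylinder M X t z) \<omega>)"
    by (intro Bochner_Integration.integrable_cong) auto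
  then show ?thesis
    by (simp add: Bochner_Integration.integrable_sum integrable_cylinder del: sum_mult_indicator)
qed

text \<open>The Markov property in integrated form: split into cylinders up to time \<open>t\<close>
  and the next state \<open>b\<close>, whose joint probabilities factor by
  \<open>cylinder_Suc\<close>.\<close>

lemma one_step_expectation:
  assumes "determined_by X t f"
  shows "expectation (\<lambda>\<omega>. f \<omega> * G (X t \<omega>) (X (Suc t) \<omega>)) =
    expectation (\<lambda>\<omega>. f \<omega> * (\<Sum>b\<in>UNIV. P $ X t \<omega> $ b * G (X t \<omega>) b))"
proof -
  let ?Z = "PiE {..t} (\<lambda>_. UNIV) :: (nat \<Rightarrow> 's) set"
  obtain c where f: "\<forall>H. \<forall>\<omega>\<in>space M. f \<omega> * H (X t \<omega>) =
      (\<Sum>z\<in>?Z. c z * H (z t) * indicator (cylinder M X t z) \<omega>)"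
    using determined_by_cylinders[OF assms] by blast
  have ext: "cylinder M X t (z(Suc t := b)) = cylinder M X t z" for z b
    by (auto simp: cylinder_def)
  have ind: "indicator (cylinder M X (Suc t) (z(Suc t := b))) \<omega> =
      indicator (cylinder M X t z) \<omega> * (if b = X (Suc t) \<omega> then 1 else 0 :: real)" for z b \<omega>
    by (auto simp: cylinder_def indicator_def le_Suc_eq)
  have "f \<omega> * G (X t \<omega>) (X (Suc t) \<omega>) =
      (\<Sum>z\<in>?Z. \<Sum>b\<in>UNIV. c z * G (z t) b * indicator (cylinder M X (Suc t) (z(Suc t := b))) \<omega>)"
    if "\<omega> \<in> space M" for \<omega>
    unfolding ind using f[rule_format, OF that, of "\<lambda>a. G a (X (Suc t) \<omega>)"]
    \<comment> \<open>The factor \<open>H\<close> is frozen at the actual next state of \<omega>,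
      and the sum over \<open>b\<close> picks out just that state.\<close>
    by (simp add: if_distrib if_distribR cong: if_cong)
  then have "expectation (\<lambda>\<omega>. f \<omega> * G (X t \<omega>) (X (Suc t) \<omega>)) =
      expectation (\<lambda>\<omega>. \<Sum>z\<in>?Z. \<Sum>b\<in>UNIV. c z * G (z t) b * indicator (cylinder M X (Suc t) (z(Suc t := b))) \<omega>)"
    by (intro Bochner_Integration.integral_cong) auto
  also have "\<dots> = (\<Sum>z\<in>?Z. \<Sum>b\<in>UNIV. c z * G (z t) b * (measure M (cylinder M X t z) * P $ z t $ b))"
    by (simp add: Bochner_Integration.integral_sum Bochner_Integration.integrable_sum integrable_cylinder
        cylinder_Suc ext del: sum_mult_indicator)
  also have "\<dots> = (\<Sum>z\<in>?Z. c z * (\<Sum>b\<in>UNIV. P $ z t $ b * G (z t) b) * measure M (cylinder M X t z))"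
    by (simp add: sum_distrib_left sum_distrib_right mult_ac)
  also have "\<dots> = expectation (\<lambda>\<omega>. \<Sum>z\<in>?Z. c z * (\<Sum>b\<in>UNIV. P $ z t $ b * G (z t) b) * indicator (cylinder M X t z) \<omega>)"
    by (simp add: Bochner_Integration.integral_sum integrable_cylinder del: sum_mult_indicator)
  also have "\<dots> = expectation (\<lambda>\<omega>. f \<omega> * (\<Sum>b\<in>UNIV. P $ X t \<omega> $ b * G (X t \<omega>) b))"
    using f[rule_format, of _ "\<lambda>a. \<Sum>b\<in>UNIV. P $ a $ b * G a b"]
    by (intro Bochner_Integration.integral_cong) auto
  finally show ?thesis .
qed

section \<open>Moments of additive functionals with martingale increments\<close>

definition additive :: "('s \<Rightarrow> 's \<Rightarrow> real) \<Rightarrow> nat \<Rightarrow> 'a \<Rightarrow> real" where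
  "additive d t \<omega> = (\<Sum>s<t. d (X s \<omega>) (X (Suc s) \<omega>))"

lemma additive_Suc: "additive d (Suc t) \<omega> = additive d t \<omega> + d (X t \<omega>) (X (Suc t) \<omega>)"
  by (simp add: additive_def)

lemma determined_by_additive: "determined_by X t (additive d t)"
  by (auto simp: determined_by_def additive_def intro!: sum.cong)

lemma determined_by_compose:
  "determined_by X t f \<Longrightarrow> determined_by X t (\<lambda>\<omega>. h (f \<omega>))"
  unfolding determined_by_def by metis

lemma integrable_additive_step:
  fixes h :: "real \<Rightarrow> real \<Rightarrow> real"
  shows "integrable M (\<lambda>\<omega>. h (additive d t \<omega>) (d (X t \<omega>) (X (Suc t) \<omega>)))"
proof (rule determined_by_integrable)
  show "determined_by X (Suc t) (\<lambda>\<omega>. h (additive d t \<omega>) (d (X t \<omega>) (X (Suc t) \<omega>)))"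
    using determined_by_additive[of t d] unfolding determined_by_def
    by (metis le_SucI le_refl)
qed

lemma integrable_additive: "integrable M (\<lambda>\<omega>. h (additive d t \<omega>) :: real)"
  using integrable_additive_step[of "\<lambda>a _. h a"] .

lemma integrable_state: "integrable M (\<lambda>\<omega>. h (X t \<omega>) :: real)"
  by (rule determined_by_integrable[of t]) (auto simp: determined_by_def)

text \<open>The increments are orthogonal: conditioning on the past kills the cross term, so the
  second moment is the sum of the conditional variances.\<close>

lemma martingale_second_moment:
  assumes "\<And>a. (\<Sum>b\<in>UNIV. P $ a $ b * d a b) = 0"
  shows "expectation (\<lambda>\<omega>. (additive d t \<omega>)\<^sup>2) =
    (\<Sum>s<t. expectation (\<lambda>\<omega>. \<Sum>b\<in>UNIV. P $ X s \<omega> $ b * (d (X s \<omega>) b)\<^sup>2))"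
proof (induction t)
  case 0
  then show ?case by (simp add: additive_def)
next
  case (Suc t)
  let ?m = "additive d t" and ?d = "\<lambda>\<omega>. d (X t \<omega>) (X (Suc t) \<omega>)"
  note I = integrable_additive_step[of _ d t]
  have 1: "expectation (\<lambda>\<omega>. ?m \<omega> * ?d \<omega>) = 0"
    using one_step_expectation[OF determined_by_additive, of d t d] assms by simp
  have 2: "expectation (\<lambda>\<omega>. (?d \<omega>)\<^sup>2) = expectation (\<lambda>\<omega>. \<Sum>b\<in>UNIV. P $ X t \<omega> $ b * (d (X t \<omega>) b)\<^sup>2)"
    using one_step_expectation[of t "\<lambda>_. 1" "\<lambda>a b. (d a b)\<^sup>2"] by (simp add: determined_by_def)
  have "expectation (\<lambda>\<omega>. (additive d (Suc t) \<omega>)\<^sup>2) =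
      expectation (\<lambda>\<omega>. (?m \<omega>)\<^sup>2 + 2 * (?m \<omega> * ?d \<omega>) + (?d \<omega>)\<^sup>2)"
    by (simp add: additive_Suc power2_eq_square algebra_simps)
  also have "\<dots> = expectation (\<lambda>\<omega>. (?m \<omega>)\<^sup>2) + 2 * expectation (\<lambda>\<omega>. ?m \<omega> * ?d \<omega>) + expectation (\<lambda>\<omega>. (?d \<omega>)\<^sup>2)"
    using I[of "\<lambda>m _. m\<^sup>2"] I[of "\<lambda>m d. m * d"] I[of "\<lambda>_ d. d\<^sup>2"] by simp
  finally show ?case by (simp add: 1 2 Suc.IH)
qed

text \<open>Both bounds go through one induction. The term cubic in the past and linear in the
  increment has mean zero, and the others cost a multiple of the second moment, which grows
  linearly; hence quadratic growth.\<close>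

lemma martingale_fourth_moment:
  assumes zero: "\<And>a. (\<Sum>b\<in>UNIV. P $ a $ b * d a b) = 0" and K: "\<And>a b. \<bar>d a b\<bar> \<le> K"
  shows "expectation (\<lambda>\<omega>. (additive d t \<omega>)\<^sup>2) \<le> K\<^sup>2 * t" (is ?A)
    and "expectation (\<lambda>\<omega>. (additive d t \<omega>) ^ 4) \<le> 11 * K ^ 4 * (real t)\<^sup>2" (is ?B)
proof -
  have dK: "(d a b)\<^sup>2 \<le> K\<^sup>2" for a b
    using K[of a b] by (simp add: abs_le_square_iff[symmetric])
  have "?A \<and> ?B"
  proof (induction t)
    case 0
    then show ?case by (simp add: additive_def)
  next
    case (Suc t)
    let ?m = "additive d t" and ?d = "\<lambda>\<omega>. d (X t \<omega>) (X (Suc t) \<omega>)"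
    note I = integrable_additive_step[of _ d t]
    have 1: "expectation (\<lambda>\<omega>. h (?m \<omega>) * ?d \<omega>) = 0" for h
      using one_step_expectation[OF determined_by_compose[OF determined_by_additive, where h = h], of d t d] zero
      by simp
    have "expectation (\<lambda>\<omega>. (additive d (Suc t) \<omega>)\<^sup>2) \<le> expectation (\<lambda>\<omega>. (?m \<omega>)\<^sup>2 + 2 * (?m \<omega> * ?d \<omega>) + K\<^sup>2)"
    proof (rule integral_mono)
      show "(additive d (Suc t) \<omega>)\<^sup>2 \<le> (?m \<omega>)\<^sup>2 + 2 * (?m \<omega> * ?d \<omega>) + K\<^sup>2" for \<omega>
        using dK[of "X t \<omega>" "X (Suc t) \<omega>"] by (simp add: additive_Suc power2_sum)
    qed (use I[of "\<lambda>m d. (m + d)\<^sup>2"] I[of "\<lambda>m _. m\<^sup>2"] I[of "\<lambda>m d. m * d"] in \<open>simp_all add: additive_Suc\<close>)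
    also have "\<dots> = expectation (\<lambda>\<omega>. (?m \<omega>)\<^sup>2) + K\<^sup>2"
      using I[of "\<lambda>m _. m\<^sup>2"] I[of "\<lambda>m d. m * d"] 1[of "\<lambda>m. m"] by (simp add: prob_space)
    finally have A: "expectation (\<lambda>\<omega>. (additive d (Suc t) \<omega>)\<^sup>2) \<le> K\<^sup>2 * Suc t"
      using Suc.IH by (simp add: algebra_simps)
    \<comment> \<open>The term \<open>4 * (m * e ^ 3)\<close> is split by a completed square into
      twice \<open>m\<^sup>2 * e\<^sup>2\<close> and twice the fourth power of \<open>e\<close>,
      giving 8 = 6 + 2 and 3 = 1 + 2.\<close>
    have pw: "(m + e) ^ 4 \<le> m ^ 4 + 4 * (m ^ 3 * e) + 8 * K\<^sup>2 * m\<^sup>2 + 3 * K ^ 4" if e: "e\<^sup>2 \<le> K\<^sup>2" for m e :: real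
    proof -
      have "0 \<le> 2 * (m * e - e\<^sup>2)\<^sup>2" by simp
      then have "4 * (m * e ^ 3) \<le> 2 * (m\<^sup>2 * e\<^sup>2) + 2 * (e\<^sup>2)\<^sup>2"
        by (simp add: power2_eq_square power3_eq_cube algebra_simps)
      moreover have "m\<^sup>2 * e\<^sup>2 \<le> m\<^sup>2 * K\<^sup>2" using e by (intro mult_left_mono) auto
      moreover have "(e\<^sup>2)\<^sup>2 \<le> K ^ 4" using power_mono[OF e, of 2] by simp
      moreover have "(m + e) ^ 4 = m ^ 4 + 4 * (m ^ 3 * e) + 6 * (m\<^sup>2 * e\<^sup>2) + 4 * (m * e ^ 3) + (e\<^sup>2)\<^sup>2"
        by (simp add: power4_eq_xxxx power2_eq_square power3_eq_cube algebra_simps)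
      ultimately show ?thesis by (simp add: mult_ac)
    qed
    have "expectation (\<lambda>\<omega>. (additive d (Suc t) \<omega>) ^ 4) \<le>
        expectation (\<lambda>\<omega>. (?m \<omega>) ^ 4 + 4 * ((?m \<omega>) ^ 3 * ?d \<omega>) + 8 * K\<^sup>2 * (?m \<omega>)\<^sup>2 + 3 * K ^ 4)"
    proof (rule integral_mono)
      show "(additive d (Suc t) \<omega>) ^ 4 \<le> (?m \<omega>) ^ 4 + 4 * ((?m \<omega>) ^ 3 * ?d \<omega>) + 8 * K\<^sup>2 * (?m \<omega>)\<^sup>2 + 3 * K ^ 4" for \<omega>
        unfolding additive_Suc by (rule pw[OF dK])
    qed (use I[of "\<lambda>m d. (m + d) ^ 4"] I[of "\<lambda>m _. m ^ 4"] I[of "\<lambda>m _. m\<^sup>2"] I[of "\<lambda>m d. m ^ 3 * d"]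
        in \<open>simp_all add: additive_Suc\<close>)
    also have "\<dots> = expectation (\<lambda>\<omega>. (?m \<omega>) ^ 4) + 8 * K\<^sup>2 * expectation (\<lambda>\<omega>. (?m \<omega>)\<^sup>2) + 3 * K ^ 4"
      using I[of "\<lambda>m _. m ^ 4"] I[of "\<lambda>m _. m\<^sup>2"] I[of "\<lambda>m d. m ^ 3 * d"] 1[of "\<lambda>m. m ^ 3"]
      by (simp add: prob_space)
    also have "\<dots> \<le> 11 * K ^ 4 * (real t)\<^sup>2 + 8 * K\<^sup>2 * (K\<^sup>2 * t) + 3 * K ^ 4"
      using Suc.IH by (intro add_mono mult_left_mono) auto
    also have "\<dots> = K ^ 4 * (11 * (real t)\<^sup>2 + 8 * t + 3)"
      by (simp add: power4_eq_xxxx power2_eq_square algebra_simps)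
    \<comment> \<open>The constant 11 = 8 + 3 suffices, since the square grows by
      \<open>2 * t + 1\<close>.\<close>
    also have "\<dots> \<le> K ^ 4 * (11 * (real (Suc t))\<^sup>2)"
      by (intro mult_left_mono) (simp_all add: power2_eq_square algebra_simps)
    finally show ?case using A by (simp add: mult_ac)
  qed
  then show ?A ?B by auto
qed

end

section \<open>Identification of the limiting variance\<close>

text \<open>The cubic coefficient vanishes, so the Taylor remainder after the quadratic term has
  order four.\<close>

lemma cos_quadratic_remainder:
  fixes x :: real
  shows "\<bar>cos x - 1 + x\<^sup>2 / 2\<bar> \<le> x ^ 4 / 24"
proof -
  obtain t where "cos x = (\<Sum>m<4. cos_coeff m * x ^ m) + cos (t + 1 / 2 * real 4 * pi) / fact 4 * x ^ 4"
    using Maclaurin_cos_expansion[of x 4] by auto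
  then have "cos x - 1 + x\<^sup>2 / 2 = cos (t + 1 / 2 * real 4 * pi) * (x ^ 4 / 24)"
    by (simp add: numeral_eq_Suc cos_coeff_Suc sin_coeff_Suc)
  then have "\<bar>cos x - 1 + x\<^sup>2 / 2\<bar> = \<bar>cos (t + 1 / 2 * real 4 * pi)\<bar> * \<bar>x ^ 4 / 24\<bar>"
    by (simp only: abs_mult)
  also have "\<dots> \<le> 1 * \<bar>x ^ 4 / 24\<bar>"
    by (intro mult_right_mono abs_cos_le_one) simp
  finally show ?thesis by simp
qed

text \<open>Weak convergence alone does not give convergence of variances; the fourth moments supply
  the missing uniform integrability.\<close>
lemma (in prob_space) variance_of_gaussian_limit:
  fixes W :: "nat \<Rightarrow> 'a \<Rightarrow> real"
  assumes int: "\<And>t k. integrable M (\<lambda>\<omega>. W t \<omega> ^ k)"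
    and second: "(\<lambda>t. expectation (\<lambda>\<omega>. (W t \<omega>)\<^sup>2) / real t) \<longlonglongrightarrow> s"
    and fourth: "\<And>t. expectation (\<lambda>\<omega>. (W t \<omega>) ^ 4) \<le> C * (real t)\<^sup>2"
    and char: "\<And>\<theta>. (\<lambda>t. expectation (\<lambda>\<omega>. cos (\<theta> * (W t \<omega> / sqrt (real t))))) \<longlonglongrightarrow> exp (- (\<theta>\<^sup>2 * q) / 2)"
  shows "q = s"
proof -
  have [measurable]: "W t \<in> borel_measurable M" for t using int[of t 1] by simp
  \<comment> \<open>Integrate the cosine remainder. The scaling cancels the quadratic growth of the
    fourth moment, so the bound is uniform in \<open>t\<close> and survives the limit.\<close>
  have bound: "\<bar>expectation (\<lambda>\<omega>. cos (\<theta> * (W t \<omega> / sqrt (real t)))) - 1 + \<theta>\<^sup>2 / 2 * (expectation (\<lambda>\<omega>. (W t \<omega>)\<^sup>2) / real t)\<bar>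
      \<le> C * \<theta> ^ 4 / 24" if "0 < t" for t \<theta>
  proof -
    let ?f = "\<lambda>\<omega>. \<theta> * (W t \<omega> / sqrt (real t))"
    have sq: "(?f \<omega>)\<^sup>2 / 2 = \<theta>\<^sup>2 / (2 * real t) * (W t \<omega>)\<^sup>2" for \<omega>
      by (simp add: power_mult_distrib power_divide)
    have fo: "?f \<omega> ^ 4 / 24 = \<theta> ^ 4 / (24 * (real t)\<^sup>2) * (W t \<omega>) ^ 4" for \<omega>
    proof -
      have "sqrt (real t) ^ 4 = (real t)\<^sup>2"
        by (metis mult_2 numeral_Bit0 of_nat_0_le_iff power2_eq_square power_add real_sqrt_pow2)
      then show ?thesis by (simp add: power_mult_distrib power_divide)
    qed
    have c: "integrable M (\<lambda>\<omega>. cos (?f \<omega>))"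
      by (rule integrable_const_bound[where B = 1]) auto
    have "expectation (\<lambda>\<omega>. cos (?f \<omega>)) - 1 + \<theta>\<^sup>2 / 2 * (expectation (\<lambda>\<omega>. (W t \<omega>)\<^sup>2) / real t)
        = expectation (\<lambda>\<omega>. cos (?f \<omega>) - 1 + (?f \<omega>)\<^sup>2 / 2)"
      unfolding sq using c int[of t 2] by (simp add: prob_space)
    also have "\<bar>\<dots>\<bar> \<le> expectation (\<lambda>\<omega>. \<bar>cos (?f \<omega>) - 1 + (?f \<omega>)\<^sup>2 / 2\<bar>)"
      by (rule integral_abs_bound)
    also have "\<dots> \<le> expectation (\<lambda>\<omega>. ?f \<omega> ^ 4 / 24)"
    proof (rule integral_mono)
      show "integrable M (\<lambda>\<omega>. \<bar>cos (?f \<omega>) - 1 + (?f \<omega>)\<^sup>2 / 2\<bar>)"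
        unfolding sq using c int[of t 2] by simp
      show "integrable M (\<lambda>\<omega>. ?f \<omega> ^ 4 / 24)"
        unfolding fo using int[of t 4] by simp
    qed (rule cos_quadratic_remainder)
    also have "\<dots> = \<theta> ^ 4 / (24 * (real t)\<^sup>2) * expectation (\<lambda>\<omega>. (W t \<omega>) ^ 4)"
      unfolding fo by simp
    also have "\<dots> \<le> \<theta> ^ 4 / (24 * (real t)\<^sup>2) * (C * (real t)\<^sup>2)"
      by (intro mult_left_mono fourth) auto
    also have "\<dots> = C * \<theta> ^ 4 / 24" using that by simp
    finally show ?thesis .
  qed
  have lim: "\<bar>exp (- (\<theta>\<^sup>2 * q) / 2) - 1 + \<theta>\<^sup>2 / 2 * s\<bar> \<le> C * \<theta> ^ 4 / 24" for \<theta>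
  proof (rule tendsto_upperbound)
    show "(\<lambda>t. \<bar>expectation (\<lambda>\<omega>. cos (\<theta> * (W t \<omega> / sqrt (real t)))) - 1
        + \<theta>\<^sup>2 / 2 * (expectation (\<lambda>\<omega>. (W t \<omega>)\<^sup>2) / real t)\<bar>) \<longlonglongrightarrow> \<bar>exp (- (\<theta>\<^sup>2 * q) / 2) - 1 + \<theta>\<^sup>2 / 2 * s\<bar>"
      by (intro tendsto_intros char second)
    show "\<forall>\<^sub>F t in sequentially. \<bar>expectation (\<lambda>\<omega>. cos (\<theta> * (W t \<omega> / sqrt (real t)))) - 1
        + \<theta>\<^sup>2 / 2 * (expectation (\<lambda>\<omega>. (W t \<omega>)\<^sup>2) / real t)\<bar> \<le> C * \<theta> ^ 4 / 24"
      using eventually_gt_at_top[of 0] by eventually_elim (rule bound)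
  qed simp
  \<comment> \<open>With \<open>r\<close> in place of \<open>\<theta>\<^sup>2\<close>, dividing by
    \<open>r\<close> and letting \<open>r\<close> decrease to 0 turns the error bound into an
    equality of first-order coefficients.\<close>
  have "((\<lambda>r. exp (- (r * q) / 2)) has_real_derivative - q / 2) (at 0)"
    by (auto intro!: derivative_eq_intros)
  then have "((\<lambda>r. (exp (- (r * q) / 2) - 1) / r) \<longlongrightarrow> - q / 2) (at_right 0)"
    by (auto simp: has_field_derivative_iff intro: tendsto_mono[OF at_le])
  then have "((\<lambda>r. \<bar>(exp (- (r * q) / 2) - 1) / r + s / 2\<bar>) \<longlongrightarrow> \<bar>- q / 2 + s / 2\<bar>) (at_right 0)"
    by (intro tendsto_rabs tendsto_add tendsto_const)
  note lhs = this
  have rhs: "((\<lambda>r. C * r / 24) \<longlongrightarrow> C * 0 / 24) (at_right 0)"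
    by (intro tendsto_intros) simp
  have "\<bar>(exp (- (r * q) / 2) - 1) / r + s / 2\<bar> \<le> C * r / 24" if "0 < r" for r
  proof -
    have "\<bar>exp (- (r * q) / 2) - 1 + r / 2 * s\<bar> \<le> C * r\<^sup>2 / 24"
      using lim[of "sqrt r"] that
      by (metis (no_types, lifting) less_eq_real_def mult_2 numeral_Bit0 power2_eq_square power_add real_sqrt_pow2)
    then have "\<bar>exp (- (r * q) / 2) - 1 + r / 2 * s\<bar> / r \<le> C * r\<^sup>2 / 24 / r"
      using that by (intro divide_right_mono) auto
    moreover have "(exp (- (r * q) / 2) - 1) / r + s / 2 = (exp (- (r * q) / 2) - 1 + r / 2 * s) / r"
      using that by (simp add: add_divide_distrib)
    ultimately show ?thesis using that by (simp add: power2_eq_square)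
  qed
  then have "\<forall>\<^sub>F r in at_right 0. \<bar>(exp (- (r * q) / 2) - 1) / r + s / 2\<bar> \<le> C * r / 24"
    by (auto simp: eventually_at_filter)
  then have "\<bar>- q / 2 + s / 2\<bar> \<le> C * 0 / 24"
    by (rule tendsto_le[OF trivial_limit_at_right_real rhs lhs])
  then show ?thesis by simp
qed

section \<open>Accumulated homology\<close>

context finite_markov_chain
begin

lemma homology_eq_additive:
  "real_of_int (homology x y X t \<omega> i) =
    additive (\<lambda>a b. of_bool (a = x i \<and> b = y i) - of_bool (a = y i \<and> b = x i)) t \<omega>"
proof -
  have "real (card {s. s < t \<and> Q s}) = (\<Sum>s<t. of_bool (Q s))" for Q
  proof -
    have "{s. s < t \<and> Q s} = {..<t} \<inter> {s. Q s}" by auto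
    then show ?thesis by (simp add: sum.inter_restrict[symmetric] of_bool_def sum.If_cases)
  qed
  then show ?thesis by (simp add: homology_def additive_def sum_subtractf)
qed

text \<open>The cosine of a linear functional is a bounded continuous test function, and its
  integral under the limit law is the real part of the characteristic function.\<close>

lemma homology_cos_limit:
  assumes "homology_covariance M X g x y S"
  shows "(\<lambda>t. expectation (\<lambda>\<omega>. cos (\<Sum>i=1..g. \<beta> i * (homology x y X t \<omega> i / sqrt (real t)))))
    \<longlonglongrightarrow> exp (- quad_form g S \<beta> / 2)"
proof -
  obtain N where N: "centred_normal g S N"
    and conv: "weak_conv_vec g (\<lambda>t. distr M (borel_vec g) (scaled_homology g x y X t)) N"
    using assms by (auto simp: homology_covariance_def)
  interpret N: prob_space N using N by (simp add: centred_normal_def)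
  have sets_N: "sets N = sets (borel_vec g)" using N by (simp add: centred_normal_def)
  let ?l = "\<lambda>v :: nat \<Rightarrow> real. \<Sum>i=1..g. \<beta> i * v i"
  have l: "?l \<in> borel_measurable (borel_vec g)" by measurable
  have lN: "?l \<in> borel_measurable N" using l by (simp add: measurable_cong_sets[OF sets_N refl])
  have "(\<integral>v. cos (?l v) \<partial>N) = Re (CLINT v|N. iexp (?l v))"
  proof -
    have "(\<lambda>v. iexp (?l v)) \<in> borel_measurable N"
      by (rule measurable_compose[OF lN]) (intro borel_measurable_continuous_onI continuous_intros)
    then have "integrable N (\<lambda>v. iexp (?l v))"
      by (intro N.integrable_const_bound[where B = 1]) (auto simp del: of_real_sum)
    then have "Re (CLINT v|N. iexp (?l v)) = (\<integral>v. Re (iexp (?l v)) \<partial>N)" by simp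
    then show ?thesis by (simp add: Re_exp)
  qed
  then have N_cos: "(\<integral>v. cos (?l v) \<partial>N) = exp (- quad_form g S \<beta> / 2)"
    using N by (simp add: centred_normal_def)
  have cont: "continuous_on (PiE {1..g} (\<lambda>_. UNIV)) (\<lambda>v. cos (?l v))"
    by (intro continuous_intros continuous_on_subset[OF continuous_on_product_coordinates]) auto
  have "bounded ((\<lambda>v. cos (?l v)) ` PiE {1..g} (\<lambda>_. UNIV))"
    by (auto intro!: boundedI[where B = 1])
  with conv cont have lim: "(\<lambda>t. \<integral>v. cos (?l v) \<partial>distr M (borel_vec g) (scaled_homology g x y X t))
      \<longlonglongrightarrow> (\<integral>v. cos (?l v) \<partial>N)"
    unfolding weak_conv_vec_def by blast
  have meas: "scaled_homology g x y X t \<in> measurable M (borel_vec g)" for t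
    unfolding scaled_homology_def
    by (intro measurable_restrict borel_measurable_divide borel_measurable_const)
      (unfold homology_eq_additive, rule borel_measurable_integrable[OF integrable_additive[of "\<lambda>a. a"]])
  have "(\<integral>v. cos (?l v) \<partial>distr M (borel_vec g) (scaled_homology g x y X t)) =
      expectation (\<lambda>\<omega>. cos (\<Sum>i=1..g. \<beta> i * (homology x y X t \<omega> i / sqrt (real t))))" for t
    using l by (subst integral_distr[OF meas]) (auto simp: scaled_homology_def intro!: arg_cong[where f = cos] sum.cong Bochner_Integration.integral_cong)
  with lim N_cos show ?thesis by simp
qed

end

section \<open>Ergodic averages and the limiting variance of additive functionals\<close>

locale reversible_markov_chain =
  reversible_irreducible_chain P \<pi> + finite_markov_chain M X P
  for P :: "real^'v^'v::finite" and \<pi> :: "real^'v" and M :: "'a measure" and X :: "nat \<Rightarrow> 'a \<Rightarrow> 'v"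
begin

lemma finite_state_bound:
  fixes f :: "'v \<Rightarrow> real"
  obtains B where "\<And>a. \<bar>f a\<bar> \<le> B"
proof (rule that)
  show "\<bar>f a\<bar> \<le> Max (range (\<lambda>a. \<bar>f a\<bar>))" for a by simp
qed

text \<open>Ergodic averages of \<open>v\<close> telescope along a solution of the Poisson equation for \<open>v\<close>.\<close>
lemma ergodic_average:
  "(\<lambda>t. (\<Sum>s<t. expectation (\<lambda>\<omega>. v (X s \<omega>))) / real t) \<longlonglongrightarrow> (\<Sum>a\<in>UNIV. \<pi> $ a * v a)"
proof -
  define m where "m = (\<Sum>a\<in>UNIV. \<pi> $ a * v a)"
  have "(\<Sum>a\<in>UNIV. \<pi> $ a * (\<chi> a. v a - m) $ a) = 0"
    by (simp add: right_diff_distrib sum_subtractf sum_distrib_right[symmetric] \<pi>_sum m_def)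
  then obtain w where w: "w - P *v w = (\<chi> a. v a - m)" by (rule poisson_exists)
  have v: "v a = w $ a - (P *v w) $ a + m" for a
    using arg_cong[OF w, of "\<lambda>u. u $ a"] by simp
  have step: "expectation (\<lambda>\<omega>. (P *v w) $ X s \<omega>) = expectation (\<lambda>\<omega>. w $ X (Suc s) \<omega>)" for s
    using one_step_expectation[of s "\<lambda>_. 1" "\<lambda>a b. w $ b"]
    by (simp add: determined_by_def matrix_vector_mult_def)
  have E: "(\<Sum>s<t. expectation (\<lambda>\<omega>. v (X s \<omega>))) =
      expectation (\<lambda>\<omega>. w $ X 0 \<omega>) - expectation (\<lambda>\<omega>. w $ X t \<omega>) + real t * m" for t
  proof (induction t)
    case (Suc t)
    have "expectation (\<lambda>\<omega>. v (X t \<omega>)) = expectation (\<lambda>\<omega>. w $ X t \<omega>) - expectation (\<lambda>\<omega>. w $ X (Suc t) \<omega>) + m"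
      unfolding v step[symmetric]
      using integrable_state[of "\<lambda>a. w $ a" t] integrable_state[of "\<lambda>a. (P *v w) $ a" t]
      by (simp add: prob_space)
    with Suc show ?case by (simp add: algebra_simps)
  qed simp
  obtain B where B: "\<bar>w $ a\<bar> \<le> B" for a by (rule finite_state_bound[of "\<lambda>a. w $ a"]) auto
  have wB: "\<bar>expectation (\<lambda>\<omega>. w $ X t \<omega>)\<bar> \<le> B" for t
  proof -
    have "\<bar>expectation (\<lambda>\<omega>. w $ X t \<omega>)\<bar> \<le> expectation (\<lambda>\<omega>. \<bar>w $ X t \<omega>\<bar>)"
      by (rule integral_abs_bound)
    also have "\<dots> \<le> expectation (\<lambda>\<omega>. B)"
      using B integrable_state[of "\<lambda>a. \<bar>w $ a\<bar>" t] by (intro integral_mono) auto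
    finally show ?thesis by (simp add: prob_space)
  qed
  have "(\<lambda>t. (expectation (\<lambda>\<omega>. w $ X 0 \<omega>) - expectation (\<lambda>\<omega>. w $ X t \<omega>)) / real t) \<longlonglongrightarrow> 0"
  proof (rule Lim_null_comparison)
    show "\<forall>\<^sub>F t in sequentially. norm ((expectation (\<lambda>\<omega>. w $ X 0 \<omega>) - expectation (\<lambda>\<omega>. w $ X t \<omega>)) / real t)
        \<le> 2 * B / real t"
    proof (intro always_eventually allI)
      fix t
      have "\<bar>expectation (\<lambda>\<omega>. w $ X 0 \<omega>) - expectation (\<lambda>\<omega>. w $ X t \<omega>)\<bar> \<le> 2 * B"
        using wB[of 0] wB[of t] by linarith
      then show "norm ((expectation (\<lambda>\<omega>. w $ X 0 \<omega>) - expectation (\<lambda>\<omega>. w $ X t \<omega>)) / real t) \<le> 2 * B / real t"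
        by (simp add: abs_divide divide_right_mono)
    qed
    show "(\<lambda>t. 2 * B / real t) \<longlonglongrightarrow> 0" by (rule lim_const_over_n)
  qed
  then have "(\<lambda>t. (expectation (\<lambda>\<omega>. w $ X 0 \<omega>) - expectation (\<lambda>\<omega>. w $ X t \<omega>)) / real t + m) \<longlonglongrightarrow> 0 + m"
    by (intro tendsto_add tendsto_const)
  then have "(\<lambda>t. (expectation (\<lambda>\<omega>. w $ X 0 \<omega>) - expectation (\<lambda>\<omega>. w $ X t \<omega>)) / real t + m) \<longlonglongrightarrow> m"
    by simp
  moreover have "\<forall>\<^sub>F t in sequentially. (expectation (\<lambda>\<omega>. w $ X 0 \<omega>) - expectation (\<lambda>\<omega>. w $ X t \<omega>)) / real t + m
      = (\<Sum>s<t. expectation (\<lambda>\<omega>. v (X s \<omega>))) / real t"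
    using eventually_gt_at_top[of 0] by eventually_elim (simp add: E add_divide_distrib)
  ultimately show ?thesis unfolding m_def by (rule Lim_transform_eventually)
qed

text \<open>Martingale approximation: the coboundary \<open>u $ b - u $ a\<close> cancels the drift
  of \<phi> and changes the sum only by a bounded amount, so the limit law is unchanged and the
  moment bounds for martingales apply.\<close>

lemma additive_variance:
  assumes u: "\<And>a. u $ a - (P *v u) $ a = (\<Sum>b\<in>UNIV. P $ a $ b * \<phi> a b)"
    and lim: "\<And>\<theta>. (\<lambda>t. expectation (\<lambda>\<omega>. cos (\<theta> * (additive \<phi> t \<omega> / sqrt (real t)))))
      \<longlonglongrightarrow> exp (- (\<theta>\<^sup>2 * q) / 2)"
  shows "q = (\<Sum>a\<in>UNIV. \<pi> $ a * (\<Sum>b\<in>UNIV. P $ a $ b * (\<phi> a b + u $ b - u $ a)\<^sup>2))"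
proof -
  define d where "d a b = \<phi> a b + u $ b - u $ a" for a b
  have martingale: "(\<Sum>b\<in>UNIV. P $ a $ b * d a b) = 0" for a
  proof -
    have "(\<Sum>b\<in>UNIV. P $ a $ b * d a b) =
        (\<Sum>b\<in>UNIV. P $ a $ b * \<phi> a b) + (P *v u) $ a - (\<Sum>b\<in>UNIV. P $ a $ b) * u $ a"
      by (simp add: d_def distrib_left right_diff_distrib sum.distrib sum_subtractf
          sum_distrib_right matrix_vector_mult_def)
    then show ?thesis by (simp add: row_sum flip: u)
  qed
  have d_additive: "additive d t \<omega> = additive \<phi> t \<omega> + u $ X t \<omega> - u $ X 0 \<omega>" for t \<omega>
    by (induction t) (simp_all add: additive_def d_def)
  obtain K where K: "\<bar>d a b\<bar> \<le> K" for a b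
  proof -
    have "\<bar>d a b\<bar> \<le> Max (range (\<lambda>(a, b). \<bar>d a b\<bar>))" for a b
      by (rule Max_ge) (auto intro: image_eqI[of _ _ "(a, b)"])
    then show thesis by (rule that)
  qed
  obtain B where B: "\<bar>u $ a\<bar> \<le> B" for a by (rule finite_state_bound[of "\<lambda>a. u $ a"]) auto
  have lim_d: "(\<lambda>t. expectation (\<lambda>\<omega>. cos (\<theta> * (additive d t \<omega> / sqrt (real t))))) \<longlonglongrightarrow> exp (- (\<theta>\<^sup>2 * q) / 2)" for \<theta>
  proof -
    let ?c = "\<lambda>d t \<omega>. cos (\<theta> * (additive d t \<omega> / sqrt (real t)))"
    have int: "integrable M (?c d t)" for d t by (rule integrable_additive)
    \<comment> \<open>Cosine is 1-Lipschitz. The bound also holds at \<open>t = 0\<close>, where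
      division by zero makes both sides 0.\<close>
    have diff: "\<bar>?c d t \<omega> - ?c \<phi> t \<omega>\<bar> \<le> \<bar>\<theta>\<bar> * (2 * B) / sqrt (real t)" for t \<omega>
    proof -
      have "\<bar>additive d t \<omega> - additive \<phi> t \<omega>\<bar> \<le> 2 * B"
        using B[of "X t \<omega>"] B[of "X 0 \<omega>"] unfolding d_additive by linarith
      then have "\<bar>\<theta>\<bar> * \<bar>additive d t \<omega> - additive \<phi> t \<omega>\<bar> / sqrt (real t) \<le> \<bar>\<theta>\<bar> * (2 * B) / sqrt (real t)"
        by (intro divide_right_mono mult_left_mono) auto
      moreover have "\<bar>cos a - cos b\<bar> \<le> \<bar>a - b\<bar>" for a b :: real
      proof -
        have "\<bar>cos a - cos b\<bar> = 2 * (\<bar>sin ((a + b) / 2)\<bar> * \<bar>sin ((b - a) / 2)\<bar>)"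
          by (simp add: cos_diff_cos abs_mult)
        also have "\<dots> \<le> 2 * (1 * \<bar>(b - a) / 2\<bar>)"
          by (intro mult_left_mono mult_mono abs_sin_x_le_abs_x) auto
        finally show ?thesis by simp
      qed
      then have "\<bar>?c d t \<omega> - ?c \<phi> t \<omega>\<bar> \<le> \<bar>\<theta> * (additive d t \<omega> / sqrt (real t)) - \<theta> * (additive \<phi> t \<omega> / sqrt (real t))\<bar>" .
      moreover have "\<theta> * (additive d t \<omega> / sqrt (real t)) - \<theta> * (additive \<phi> t \<omega> / sqrt (real t))
          = \<theta> * (additive d t \<omega> - additive \<phi> t \<omega>) / sqrt (real t)"
        by (simp add: diff_divide_distrib right_diff_distrib)
      ultimately show ?thesis by (simp add: abs_mult)
    qed
    have "(\<lambda>t. expectation (?c d t) - expectation (?c \<phi> t)) \<longlonglongrightarrow> 0"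
    proof (rule Lim_null_comparison)
      show "\<forall>\<^sub>F t in sequentially. norm (expectation (?c d t) - expectation (?c \<phi> t)) \<le> \<bar>\<theta>\<bar> * (2 * B) / sqrt (real t)"
      proof (intro always_eventually allI)
        fix t
        have "norm (expectation (?c d t) - expectation (?c \<phi> t)) = \<bar>expectation (\<lambda>\<omega>. ?c d t \<omega> - ?c \<phi> t \<omega>)\<bar>"
          using int by simp
        also have "\<dots> \<le> expectation (\<lambda>\<omega>. \<bar>?c d t \<omega> - ?c \<phi> t \<omega>\<bar>)"
          by (rule integral_abs_bound)
        also have "\<dots> \<le> expectation (\<lambda>\<omega>. \<bar>\<theta>\<bar> * (2 * B) / sqrt (real t))"
          using int diff by (intro integral_mono) auto
        finally show "norm (expectation (?c d t) - expectation (?c \<phi> t)) \<le> \<bar>\<theta>\<bar> * (2 * B) / sqrt (real t)"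
          by (simp add: prob_space)
      qed
      show "(\<lambda>t. \<bar>\<theta>\<bar> * (2 * B) / sqrt (real t)) \<longlonglongrightarrow> 0" by real_asymp
    qed
    from tendsto_add[OF this lim[of \<theta>]] show ?thesis by simp
  qed
  show ?thesis unfolding d_def[symmetric]
  proof (rule variance_of_gaussian_limit[where W = "additive d"])
    show "integrable M (\<lambda>\<omega>. additive d t \<omega> ^ k)" for t k by (rule integrable_additive)
    show "(\<lambda>t. expectation (\<lambda>\<omega>. (additive d t \<omega>)\<^sup>2) / real t)
        \<longlonglongrightarrow> (\<Sum>a\<in>UNIV. \<pi> $ a * (\<Sum>b\<in>UNIV. P $ a $ b * (d a b)\<^sup>2))"
      unfolding martingale_second_moment[OF martingale] by (rule ergodic_average)
    show "expectation (\<lambda>\<omega>. additive d t \<omega> ^ 4) \<le> 11 * K ^ 4 * (real t)\<^sup>2" for t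
      by (rule martingale_fourth_moment[OF martingale K])
  qed (rule lim_d)
qed

end

section \<open>Stationary variance of antisymmetric functions\<close>

context reversible_irreducible_chain
begin

text \<open>Exchanging \<open>a\<close> and \<open>b\<close> preserves the stationary edge weights
  and reverses the sign of \<phi>.\<close>

lemma antisymmetric_flow:
  assumes "\<And>a b. \<phi> b a = - \<phi> a b"
  shows "(\<Sum>a\<in>UNIV. \<Sum>b\<in>UNIV. \<pi> $ a * P $ a $ b * \<phi> a b * w b)
    = - (\<Sum>a\<in>UNIV. \<Sum>b\<in>UNIV. \<pi> $ a * P $ a $ b * \<phi> a b * w a)"
proof -
  have "(\<Sum>a\<in>UNIV. \<Sum>b\<in>UNIV. \<pi> $ a * P $ a $ b * \<phi> a b * w b)
      = (\<Sum>b\<in>UNIV. \<Sum>a\<in>UNIV. \<pi> $ a * P $ a $ b * \<phi> a b * w b)"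
    by (rule sum.swap)
  also have "\<dots> = (\<Sum>b\<in>UNIV. \<Sum>a\<in>UNIV. - (\<pi> $ b * P $ b $ a * \<phi> b a * w b))"
  proof (intro sum.cong refl)
    show "\<pi> $ a * P $ a $ b * \<phi> a b * w b = - (\<pi> $ b * P $ b $ a * \<phi> b a * w b)" for a b
      by (simp add: detailed_balance[of a b] assms[of a b])
  qed
  finally show ?thesis by (simp add: sum_negf)
qed

text \<open>Expand the square under the stationary edge weights: the cross terms contribute -4
  \<langle>u, h\<rangle> by antisymmetry, and the terms in \<open>u\<close> alone give 2 \<langle>u,
  (I - P) u\<rangle>, which is 2 \<langle>u, h\<rangle>.\<close>

lemma antisymmetric_variance:
  assumes anti: "\<And>a b. \<phi> b a = - \<phi> a b"
    and h: "\<And>a. h $ a = (\<Sum>b\<in>UNIV. P $ a $ b * \<phi> a b)"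
    and u: "u - P *v u = h"
  shows "(\<Sum>a\<in>UNIV. \<pi> $ a * (\<Sum>b\<in>UNIV. P $ a $ b * (\<phi> a b + u $ b - u $ a)\<^sup>2)) =
    (\<Sum>a\<in>UNIV. \<Sum>b\<in>UNIV. \<pi> $ a * P $ a $ b * (\<phi> a b)\<^sup>2) - 2 * inner_pi \<pi> u h"
proof -
  let ?E = "\<lambda>f. \<Sum>a\<in>UNIV. \<Sum>b\<in>UNIV. \<pi> $ a * P $ a $ b * f a b"
  have 1: "?E (\<lambda>a b. \<phi> a b * u $ a) = inner_pi \<pi> u h"
    by (simp add: inner_pi_def h sum_distrib_left mult_ac)
  have 2: "?E (\<lambda>a b. \<phi> a b * u $ b) = - inner_pi \<pi> u h"
    using antisymmetric_flow[OF anti, where w = "\<lambda>a. u $ a"] 1 by (simp add: mult.assoc)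
  have 3: "?E (\<lambda>a b. (u $ a)\<^sup>2) = inner_pi \<pi> u u"
    by (simp add: inner_pi_def sum_distrib_right[symmetric] sum_distrib_left[symmetric] row_sum
        power2_eq_square mult_ac)
  have 4: "?E (\<lambda>a b. (u $ b)\<^sup>2) = inner_pi \<pi> u u"
    by (subst 3[symmetric], subst sum.swap) (simp add: detailed_balance)
  have 5: "?E (\<lambda>a b. u $ a * u $ b) = inner_pi \<pi> u (P *v u)"
    by (simp add: inner_pi_def matrix_vector_mult_def sum_distrib_left mult_ac)
  have "(\<Sum>a\<in>UNIV. \<pi> $ a * (\<Sum>b\<in>UNIV. P $ a $ b * (\<phi> a b + u $ b - u $ a)\<^sup>2)) =
      ?E (\<lambda>a b. (\<phi> a b)\<^sup>2 + 2 * (\<phi> a b * u $ b) - 2 * (\<phi> a b * u $ a)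
        + (u $ b)\<^sup>2 + (u $ a)\<^sup>2 - 2 * (u $ a * u $ b))"
    by (simp add: sum_distrib_left power2_eq_square algebra_simps)
  also have "\<dots> = ?E (\<lambda>a b. (\<phi> a b)\<^sup>2) + 2 * ?E (\<lambda>a b. \<phi> a b * u $ b) - 2 * ?E (\<lambda>a b. \<phi> a b * u $ a)
      + ?E (\<lambda>a b. (u $ b)\<^sup>2) + ?E (\<lambda>a b. (u $ a)\<^sup>2) - 2 * ?E (\<lambda>a b. u $ a * u $ b)"
    by (simp only: distrib_left right_diff_distrib sum.distrib sum_subtractf
        mult.left_commute[of _ 2] sum_distrib_left[symmetric])
  also have "\<dots> = ?E (\<lambda>a b. (\<phi> a b)\<^sup>2) - 4 * inner_pi \<pi> u h + 2 * inner_pi \<pi> u (u - P *v u)"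
    unfolding 1 2 3 4 5 by (simp add: bilinear_rsub[OF bilinear_inner_pi])
  finally show ?thesis by (simp add: u)
qed

end

section \<open>The 1-cochain that weights crossings of the complementary edges by \<alpha>\<close>

definition edge_flow :: "nat \<Rightarrow> (nat \<Rightarrow> 'v) \<Rightarrow> (nat \<Rightarrow> 'v) \<Rightarrow> (nat \<Rightarrow> real) \<Rightarrow> 'v \<Rightarrow> 'v \<Rightarrow> real" where
  "edge_flow g x y \<alpha> a b =
    (\<Sum>i=1..g. \<alpha> i * (of_bool (a = x i \<and> b = y i) - of_bool (a = y i \<and> b = x i)))"

lemma edge_flow_antisymmetric: "edge_flow g x y \<alpha> b a = - edge_flow g x y \<alpha> a b"
  unfolding edge_flow_def sum_negf[symmetric] by (intro sum.cong refl) (simp add: right_diff_distrib conj_commute)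

text \<open>Distinct endpoints matter: at a loop the two indicators would cancel, while
  \<open>edge_fun\<close> would return its first branch.\<close>

lemma edge_flow_drift:
  fixes P :: "real^'v^'v::finite"
  assumes "\<And>i. i \<in> {1..g} \<Longrightarrow> x i \<noteq> y i"
  shows "(\<Sum>i=1..g. \<alpha> i *\<^sub>R edge_fun P x y i) $ a = (\<Sum>b\<in>UNIV. P $ a $ b * edge_flow g x y \<alpha> a b)"
proof -
  have pair: "(\<Sum>b\<in>UNIV. P $ a $ b * of_bool (a = c \<and> b = d)) = of_bool (a = c) * P $ c $ d" for c d
    by (cases "a = c") (simp_all add: of_bool_def if_distrib cong: if_cong)
  have "edge_fun P x y i $ a =
      (\<Sum>b\<in>UNIV. P $ a $ b * (of_bool (a = x i \<and> b = y i) - of_bool (a = y i \<and> b = x i)))"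
    if "i \<in> {1..g}" for i
    unfolding right_diff_distrib sum_subtractf pair using assms[OF that] by (simp add: edge_fun_def)
  then have "(\<Sum>i=1..g. \<alpha> i *\<^sub>R edge_fun P x y i) $ a =
      (\<Sum>i=1..g. \<Sum>b\<in>UNIV. \<alpha> i * (P $ a $ b * (of_bool (a = x i \<and> b = y i) - of_bool (a = y i \<and> b = x i))))"
    by (simp add: sum_component sum_distrib_left)
  also have "\<dots> = (\<Sum>b\<in>UNIV. P $ a $ b * edge_flow g x y \<alpha> a b)"
    by (subst sum.swap) (simp add: edge_flow_def sum_distrib_left mult_ac)
  finally show ?thesis .
qed

text \<open>Distinct complementary edges have disjoint supports, so mixed products vanish. At most
  one orientation of an edge matches \<open>(a, b)\<close>, so squaring turns the difference of
  indicators into their sum.\<close>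

lemma edge_flow_square:
  assumes ne: "\<And>i. i \<in> {1..g} \<Longrightarrow> x i \<noteq> y i" and inj: "inj_on (\<lambda>i. {x i, y i}) {1..g}"
  shows "(edge_flow g x y \<alpha> a b)\<^sup>2 =
    (\<Sum>i=1..g. (\<alpha> i)\<^sup>2 * (of_bool (a = x i \<and> b = y i) + of_bool (a = y i \<and> b = x i)))"
proof -
  define e :: "nat \<Rightarrow> real" where "e i = of_bool (a = x i \<and> b = y i) - of_bool (a = y i \<and> b = x i)" for i
  have sq: "(e i)\<^sup>2 = of_bool (a = x i \<and> b = y i) + of_bool (a = y i \<and> b = x i)" if "i \<in> {1..g}" for i
    using ne[OF that] by (auto simp: e_def)
  have supp: "{x i, y i} = {a, b}" if "e i \<noteq> 0" for i
  proof -
    have "a = x i \<and> b = y i \<or> a = y i \<and> b = x i"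
      using that unfolding e_def by (rule contrapos_np) auto
    then show ?thesis by (elim disjE conjE) (simp_all add: insert_commute)
  qed
  have orth: "e i * e j = 0" if "i \<in> {1..g}" "j \<in> {1..g}" "i \<noteq> j" for i j
  proof (rule ccontr)
    assume "e i * e j \<noteq> 0"
    then have "{x i, y i} = {x j, y j}" using supp[of i] supp[of j] by simp
    from inj_onD[OF inj this that(1,2)] that(3) show False by simp
  qed
  have "(edge_flow g x y \<alpha> a b)\<^sup>2 = (\<Sum>i=1..g. \<Sum>j=1..g. \<alpha> i * \<alpha> j * (e i * e j))"
    unfolding edge_flow_def e_def[symmetric] power2_eq_square sum_product
    by (intro sum.cong refl) (simp add: mult_ac)
  also have "\<dots> = (\<Sum>i=1..g. \<Sum>j=1..g. if j = i then (\<alpha> i)\<^sup>2 * (e i)\<^sup>2 else 0)"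
    using orth by (intro sum.cong refl) (auto simp: power2_eq_square)
  also have "\<dots> = (\<Sum>i=1..g. (\<alpha> i)\<^sup>2 * (e i)\<^sup>2)"
    by (intro sum.cong refl) simp
  finally show ?thesis using sq by simp
qed

theorem mainTheorem7:
  fixes E T :: "'v::finite set set"
    and P :: "real^'v^'v"
    and \<pi> :: "real^'v"
    and \<pi>E :: "real^('v \<times> 'v)"
    and M :: "'a measure"
    and X :: "nat \<Rightarrow> 'a \<Rightarrow> 'v"
    and g :: nat
    and x y :: "nat \<Rightarrow> 'v"
    and S :: "nat \<Rightarrow> nat \<Rightarrow> real"
    and \<alpha> :: "nat \<Rightarrow> real"
  assumes "simple_graph E" and "graph_connected E"
    and "stochastic P" and "supported_on_graph E P"
    and "irreducible_chain P" and "aperiodic_chain P" and "lazy_chain P"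
    and "stationary_distribution P \<pi>" and "reversible_chain P \<pi>"
    and "markov_chain M X P"
    and "edge_stationary P \<pi>E"
    and "spanning_tree E T" and "oriented_complement E T g x y"
    and "homology_covariance M X g x y S"
  shows "(quad_form g S \<alpha> =
           2 * (\<Sum>i=1..g. (\<alpha> i)\<^sup>2 * \<pi>E $ (x i, y i))
         - 2 * inner_pi \<pi> (inv_I_minus P \<pi> (\<Sum>i=1..g. \<alpha> i *\<^sub>R edge_fun P x y i))
                          (\<Sum>j=1..g. \<alpha> j *\<^sub>R edge_fun P x y j))
       \<and> (2 * (\<Sum>i=1..g. (\<alpha> i)\<^sup>2 * \<pi>E $ (x i, y i))
         - 2 * (norm_pi \<pi> (\<Sum>i=1..g. \<alpha> i *\<^sub>R edge_fun P x y i))\<^sup>2 / spectral_gap P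
         \<le> quad_form g S \<alpha>)
       \<and> (quad_form g S \<alpha> \<le>
           2 * (\<Sum>i=1..g. (\<alpha> i)\<^sup>2 * \<pi>E $ (x i, y i))
         - 2 * (norm_pi \<pi> (\<Sum>i=1..g. \<alpha> i *\<^sub>R edge_fun P x y i))\<^sup>2 / (1 - min_eigenvalue P))"
proof -
  interpret reversible_markov_chain P \<pi> M X
    by unfold_locales (rule assms)+
  have bij: "bij_betw (\<lambda>i. {x i, y i}) {1..g} (E - T)"
    using assms(13) by (simp add: oriented_complement_def)
  then have inj: "inj_on (\<lambda>i. {x i, y i}) {1..g}" by (simp add: bij_betw_def)
  have ne: "x i \<noteq> y i" if "i \<in> {1..g}" for i
  proof
    assume "x i = y i"
    moreover have "{x i, y i} \<in> E" using bij_betwE[OF bij] that by blast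
    ultimately show False using assms(1) by (force simp: simple_graph_def)
  qed
  define h where "h = (\<Sum>i=1..g. \<alpha> i *\<^sub>R edge_fun P x y i)"
  let ?\<phi> = "edge_flow g x y \<alpha>"
  have h: "h $ a = (\<Sum>b\<in>UNIV. P $ a $ b * ?\<phi> a b)" for a
    unfolding h_def by (rule edge_flow_drift[OF ne])
  \<comment> \<open>With constant weight 1, antisymmetry says that the mean drift is its own
    negative. This makes the Poisson equation solvable.\<close>
  have "(\<Sum>a\<in>UNIV. \<pi> $ a * h $ a) = 0"
    using antisymmetric_flow[where \<phi> = ?\<phi> and w = "\<lambda>_. 1", OF edge_flow_antisymmetric]
    by (simp add: h sum_distrib_left mult.assoc)
  then obtain u where u: "u - P *v u = h" and u0: "(\<Sum>a\<in>UNIV. \<pi> $ a * u $ a) = 0"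
    by (rule poisson_exists)
  have "additive ?\<phi> t \<omega> = (\<Sum>i=1..g. \<alpha> i * homology x y X t \<omega> i)" for t \<omega>
    unfolding homology_eq_additive
    by (simp add: additive_def edge_flow_def sum_distrib_left) (rule sum.swap)
  then have scaled: "\<theta> * (additive ?\<phi> t \<omega> / sqrt (real t)) =
      (\<Sum>i=1..g. (\<theta> * \<alpha> i) * (homology x y X t \<omega> i / sqrt (real t)))" for \<theta> t \<omega>
    by (simp add: sum_distrib_left sum_divide_distrib mult_ac)
  \<comment> \<open>Testing the vector limit along the multiples of \<alpha> reduces it to a
    one-dimensional Gaussian of variance \<open>quad_form g S \<alpha>\<close>.\<close>
  have quad: "quad_form g S (\<lambda>i. \<theta> * \<alpha> i) = \<theta>\<^sup>2 * quad_form g S \<alpha>" for \<theta>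
    by (simp add: quad_form_def sum_distrib_left power2_eq_square mult_ac)
  have "quad_form g S \<alpha> = (\<Sum>a\<in>UNIV. \<pi> $ a * (\<Sum>b\<in>UNIV. P $ a $ b * (?\<phi> a b + u $ b - u $ a)\<^sup>2))"
  proof (rule additive_variance)
    show "u $ a - (P *v u) $ a = (\<Sum>b\<in>UNIV. P $ a $ b * ?\<phi> a b)" for a
      using arg_cong[OF u, of "\<lambda>v. v $ a"] by (simp add: h)
    show "(\<lambda>t. expectation (\<lambda>\<omega>. cos (\<theta> * (additive ?\<phi> t \<omega> / sqrt (real t)))))
        \<longlonglongrightarrow> exp (- (\<theta>\<^sup>2 * quad_form g S \<alpha>) / 2)" for \<theta>
      unfolding scaled quad[symmetric] by (rule homology_cos_limit[OF assms(14)])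
  qed
  also have "\<dots> = (\<Sum>a\<in>UNIV. \<Sum>b\<in>UNIV. \<pi> $ a * P $ a $ b * (?\<phi> a b)\<^sup>2) - 2 * inner_pi \<pi> u h"
    by (rule antisymmetric_variance[OF edge_flow_antisymmetric h u])
  \<comment> \<open>The factor 2 counts the two orientations of each edge, which have equal mass by
    detailed balance.\<close>
  also have "(\<Sum>a\<in>UNIV. \<Sum>b\<in>UNIV. \<pi> $ a * P $ a $ b * (?\<phi> a b)\<^sup>2) = 2 * (\<Sum>i=1..g. (\<alpha> i)\<^sup>2 * \<pi>E $ (x i, y i))"
  proof -
    have pair: "(\<Sum>a\<in>UNIV. \<Sum>b\<in>UNIV. f a b * of_bool (a = c \<and> b = d)) = f c d"
      for f :: "'v \<Rightarrow> 'v \<Rightarrow> real" and c d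
    proof -
      have "(\<Sum>b\<in>UNIV. f a b * of_bool (a = c \<and> b = d)) = (if a = c then f c d else 0)" for a
        by (cases "a = c") (simp_all add: of_bool_def if_distrib cong: if_cong)
      then show ?thesis by simp
    qed
    have "(\<Sum>a\<in>UNIV. \<Sum>b\<in>UNIV. \<pi> $ a * P $ a $ b * (?\<phi> a b)\<^sup>2) =
        (\<Sum>a\<in>UNIV. \<Sum>b\<in>UNIV. \<Sum>i=1..g. (\<alpha> i)\<^sup>2 * (\<pi> $ a * P $ a $ b * of_bool (a = x i \<and> b = y i)
          + \<pi> $ a * P $ a $ b * of_bool (a = y i \<and> b = x i)))"
      by (subst edge_flow_square[OF ne inj]) (simp_all add: sum_distrib_left algebra_simps)
    also have "\<dots> = (\<Sum>i=1..g. \<Sum>a\<in>UNIV. \<Sum>b\<in>UNIV. (\<alpha> i)\<^sup>2 * (\<pi> $ a * P $ a $ b * of_bool (a = x i \<and> b = y i)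
          + \<pi> $ a * P $ a $ b * of_bool (a = y i \<and> b = x i)))"
      by (subst sum.swap, subst (2) sum.swap) (rule refl)
    also have "\<dots> = (\<Sum>i=1..g. (\<alpha> i)\<^sup>2 * (\<pi> $ x i * P $ x i $ y i + \<pi> $ y i * P $ y i $ x i))"
      by (simp only: sum_distrib_left[symmetric] sum.distrib pair)
    also have "\<dots> = 2 * (\<Sum>i=1..g. (\<alpha> i)\<^sup>2 * \<pi>E $ (x i, y i))"
      by (simp add: edge_stationary_eq[OF assms(11)] detailed_balance[of "y _"] sum_distrib_left
          mult.left_commute)
    finally show ?thesis .
  qed
  finally have main: "quad_form g S \<alpha> = 2 * (\<Sum>i=1..g. (\<alpha> i)\<^sup>2 * \<pi>E $ (x i, y i)) - 2 * inner_pi \<pi> u h" .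
  have "0 \<le> inner_pi \<pi> h h"
    using inner_pi_pos[of h] by (cases "h = 0") (auto simp: inner_pi_def)
  then have norm: "(norm_pi \<pi> h)\<^sup>2 = inner_pi \<pi> h h" by (simp add: norm_pi_def)
  \<comment> \<open>The pairing enters with a minus sign, so its upper bound gives the lower bound
    on the variance and conversely.\<close>
  show ?thesis
    unfolding h_def[symmetric] norm inv_I_minus_eq[OF u u0]
    using main dirichlet_upper[OF u u0] dirichlet_lower[OF u] by simp
qed

end
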